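(* Let $\mathcal{H}_X$ and $\mathcal{H}_Y$ be finite-dimensional Hilbert spaces of two systems $X$ and $Y$. Let $P$ be a family of reference sets assigning to each of the Hilbert spaces $\mathcal{H}_X\otimes\mathcal{H}_Y$, $\mathcal{H}_X$, $\mathcal{H}_Y$ a convex set of states ($P(\mathcal{H}_X\otimes\mathcal{H}_Y)\subset\mathcal{D}(\mathcal{H}_X\otimes\mathcal{H}_Y)$, etc.; we write $\sigma\in P$ when $\sigma$ belongs to the set for its own space). Let $\mathbb{M}$ be a class of measurement operations on $X$. Assume: (1) for every measurement in $\mathbb{M}$ with POVM elements $(M_i)_i$, every $i$, and every $\sigma_{XY}\in P$ with ${\rm Tr}((M_i\otimes\mathbb{1}_Y)\sigma_{XY})>0$, the normalized conditional state ${\rm Tr}_X((M_i\otimes\mathbb{1}_Y)\sigma_{XY})/{\rm Tr}((M_i\otimes\mathbb{1}_Y)\sigma_{XY})$ belongs to $P$; (2) $P$ is closed under partial trace, so that in particular $\sigma_{XY}\in P$ implies $\sigma_X={\rm Tr}_Y\sigma_{XY}\in P$. Then for every state $\rho_{XY}\in\mathcal{D}(\mathcal{H}_X\otimes\mathcal{H}_Y)$, \[ E^P_R(\rho_{XY})\geq \mathbb{M}E^P_R(\rho_X)+E^P_R(\rho_Y), \] where $\rho_X={\rm Tr}_Y(\rho_{XY})$ and $\rho_Y={\rm Tr}_X(\rho_{XY})$.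
   Context: $\mathcal{D}(\mathcal{H})$ denotes the set of density operators (positive, trace one) on $\mathcal{H}$. The quantum relative entropy is $S(\rho\|\sigma)={\rm Tr}\rho\log\rho-{\rm Tr}\rho\log\sigma$ (equal to $+\infty$ if the support of $\rho$ is not contained in that of $\sigma$); for probability distributions $S((p_i)_i\|(q_i)_i)=\sum_i p_i\log(p_i/q_i)$ (infinite if some $p_i>0$ with $q_i=0$). A measurement operation $\mathcal{M}$ associated with a POVM $(M_i)_i$ ($M_i\geq0$, $\sum_iM_i=\mathbb{1}$) is the map $\mathcal{M}(Z)=\sum_i{\rm Tr}(M_iZ)|i\rangle\langle i|$ for an orthonormal set $\{|i\rangle\}$. For a class $\mathbb{M}$ of measurement operations, $\mathbb{M}S(\rho\|\sigma)=\sup_{\mathcal{M}\in\mathbb{M}}S(\mathcal{M}(\rho)\|\mathcal{M}(\sigma))$. For a reference set $P$ of states on $\mathcal{H}$, $E^P_R(\rho)=\inf_{\sigma\in P}S(\rho\|\sigma)$ and $\mathbb{M}E^P_R(\rho)=\inf_{\sigma\in P}\mathbb{M}S(\rho\|\sigma)$. *)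

theory Defs
  imports Complex_Main "HOL-Library.Extended_Real"
begin

text \<open>Operators on a finite-dimensional Hilbert space with orthonormal basis indexed
  by a finite type 'a are represented as complex matrices 'a => 'a => complex.
  The composite space H_X (x) H_Y is indexed by 'x * 'y.\<close>

type_synonym 'a cmat = "'a \<Rightarrow> 'a \<Rightarrow> complex"

definition mmult :: "('a::finite) cmat \<Rightarrow> 'a cmat \<Rightarrow> 'a cmat" where
  "mmult A B = (\<lambda>i j. \<Sum>k\<in>UNIV. A i k * B k j)"

definition idm :: "'a cmat" where
  "idm = (\<lambda>i j. if i = j then 1 else 0)"

definition trace :: "('a::finite) cmat \<Rightarrow> complex" where
  "trace A = (\<Sum>i\<in>UNIV. A i i)"

definition tensor :: "'x cmat \<Rightarrow> 'y cmat \<Rightarrow> ('x \<times> 'y) cmat" where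
  "tensor A B = (\<lambda>(i1, i2) (j1, j2). A i1 j1 * B i2 j2)"

definition ptrace_X :: "(('x::finite) \<times> 'y) cmat \<Rightarrow> 'y cmat" where
  "ptrace_X C = (\<lambda>i j. \<Sum>x\<in>UNIV. C (x, i) (x, j))"

definition ptrace_Y :: "('x \<times> ('y::finite)) cmat \<Rightarrow> 'x cmat" where
  "ptrace_Y C = (\<lambda>i j. \<Sum>y\<in>UNIV. C (i, y) (j, y))"

definition hermitian :: "'a cmat \<Rightarrow> bool" where
  "hermitian A \<longleftrightarrow> (\<forall>i j. A i j = cnj (A j i))"

definition positive :: "('a::finite) cmat \<Rightarrow> bool" where
  "positive A \<longleftrightarrow> hermitian A \<and>
     (\<forall>v :: 'a \<Rightarrow> complex. 0 \<le> Re (\<Sum>i\<in>UNIV. \<Sum>j\<in>UNIV. cnj (v i) * A i j * v j))"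

definition density :: "('a::finite) cmat \<Rightarrow> bool" where
  "density A \<longleftrightarrow> positive A \<and> trace A = 1"

definition convex_mset :: "('a::finite) cmat set \<Rightarrow> bool" where
  "convex_mset S \<longleftrightarrow> (\<forall>A\<in>S. \<forall>B\<in>S. \<forall>t::real. 0 \<le> t \<and> t \<le> 1 \<longrightarrow>
      (\<lambda>i j. of_real t * A i j + of_real (1 - t) * B i j) \<in> S)"

definition spectral_decomp :: "('a::finite) cmat \<Rightarrow> ('a \<Rightarrow> real) \<times> ('a \<Rightarrow> 'a \<Rightarrow> complex) \<Rightarrow> bool" where
  "spectral_decomp A d \<longleftrightarrow>
     (\<forall>k l. (\<Sum>i\<in>UNIV. cnj (snd d k i) * snd d l i) = (if k = l then 1 else 0)) \<and>
     (\<forall>i j. A i j = (\<Sum>k\<in>UNIV. of_real (fst d k) * snd d k i * cnj (snd d k j)))"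

definition mat_fun :: "(real \<Rightarrow> real) \<Rightarrow> ('a::finite) cmat \<Rightarrow> 'a cmat" where
  "mat_fun f A = (let d = (SOME d. spectral_decomp A d) in
     (\<lambda>i j. \<Sum>k\<in>UNIV. of_real (f (fst d k)) * snd d k i * cnj (snd d k j)))"

text \<open>supp rho \<subseteq> supp sigma, supports being orthogonal complements of kernels.\<close>
definition supp_le :: "('a::finite) cmat \<Rightarrow> 'a cmat \<Rightarrow> bool" where
  "supp_le \<rho> \<sigma> \<longleftrightarrow> (\<forall>v :: 'a \<Rightarrow> complex.
     (\<forall>i. (\<Sum>j\<in>UNIV. \<sigma> i j * v j) = 0) \<longrightarrow> (\<forall>i. (\<Sum>j\<in>UNIV. \<rho> i j * v j) = 0))"

text \<open>Quantum relative entropy S(rho||sigma) = Tr rho log rho - Tr rho log sigma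
  (natural log; log applied on the support, ln 0 = 0 in Isabelle), +infinity if
  supp rho is not contained in supp sigma.\<close>
definition rel_entropy :: "('a::finite) cmat \<Rightarrow> 'a cmat \<Rightarrow> ereal" where
  "rel_entropy \<rho> \<sigma> = (if supp_le \<rho> \<sigma>
     then ereal (Re (trace (mmult \<rho> (mat_fun ln \<rho>)) - trace (mmult \<rho> (mat_fun ln \<sigma>))))
     else \<infinity>)"

definition cl_rel_entropy :: "(nat \<Rightarrow> real) \<Rightarrow> (nat \<Rightarrow> real) \<Rightarrow> nat \<Rightarrow> ereal" where
  "cl_rel_entropy p q n = (if \<exists>i<n. p i > 0 \<and> q i = 0 then \<infinity>
     else ereal (\<Sum>i<n. p i * ln (p i / q i)))"

text \<open>A measurement operation is given by its POVM, a finite list (M_0,...,M_{n-1}).\<close>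
definition is_povm :: "('a::finite) cmat list \<Rightarrow> bool" where
  "is_povm Ms \<longleftrightarrow> (\<forall>M\<in>set Ms. positive M) \<and>
     (\<forall>i j. (\<Sum>k<length Ms. (Ms ! k) i j) = idm i j)"

text \<open>S(M(rho)||M(sigma)): relative entropy of the output (diagonal) states, i.e. of
  the outcome distributions (Tr M_i rho)_i and (Tr M_i sigma)_i.\<close>
definition meas_rel_entropy_single :: "('a::finite) cmat list \<Rightarrow> 'a cmat \<Rightarrow> 'a cmat \<Rightarrow> ereal" where
  "meas_rel_entropy_single Ms \<rho> \<sigma> =
     cl_rel_entropy (\<lambda>k. Re (trace (mmult (Ms ! k) \<rho>))) (\<lambda>k. Re (trace (mmult (Ms ! k) \<sigma>))) (length Ms)"

definition meas_rel_entropy :: "('a::finite) cmat list set \<Rightarrow> 'a cmat \<Rightarrow> 'a cmat \<Rightarrow> ereal" where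
  "meas_rel_entropy MM \<rho> \<sigma> = (SUP Ms\<in>MM. meas_rel_entropy_single Ms \<rho> \<sigma>)"

definition rel_ent_ent :: "('a::finite) cmat set \<Rightarrow> 'a cmat \<Rightarrow> ereal" where
  "rel_ent_ent P \<rho> = (INF \<sigma>\<in>P. rel_entropy \<rho> \<sigma>)"

definition meas_rel_ent_ent :: "('a::finite) cmat list set \<Rightarrow> 'a cmat set \<Rightarrow> 'a cmat \<Rightarrow> ereal" where
  "meas_rel_ent_ent MM P \<rho> = (INF \<sigma>\<in>P. meas_rel_entropy MM \<rho> \<sigma>)"

end

theory Submission
  imports "HOL-Analysis.Topology_Euclidean_Space" "HOL-Analysis.Finite_Cartesian_Product" Defs
begin

text \<open>Fix \<open>\<sigma>\<close> and a measurement \<open>(M\<^sub>k)\<close>, and let \<open>R\<^sub>k\<close>, \<open>S\<^sub>k\<close> be the unnormalised conditional states of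
  \<open>\<rho>\<close>, \<open>\<sigma>\<close> on \<open>Y\<close>, with traces \<open>p\<^sub>k\<close>, \<open>q\<^sub>k\<close>. Monotonicity of relative entropy gives
  \<open>S(\<rho>||\<sigma>) \<ge> \<Sum>k. S(R\<^sub>k||S\<^sub>k) = \<Sum>k. p\<^sub>k ln (p\<^sub>k/q\<^sub>k) + \<Sum>k. S(R\<^sub>k||(p\<^sub>k/q\<^sub>k) S\<^sub>k)\<close>, and by joint
  convexity the last sum is at least \<open>S(\<rho>\<^sub>Y||\<tau>)\<close> for the convex combination
  \<open>\<tau> = \<Sum>k. p\<^sub>k (S\<^sub>k/q\<^sub>k)\<close> of conditional states.

  Both inequalities for positive \<open>A\<close>, \<open>B\<close> come from the integral representation
  \<open>S(A||B) = \<integral>\<^sub>0\<^sup>\<infinity> (F\<^sub>t(A,B) - Tr A/(1+t)) dt\<close>, where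
  \<open>F\<^sub>t(A,B) = max\<^sub>X (2 Re Tr(AX) - Tr(B X X\<^sup>*) - t Tr(A X\<^sup>* X))\<close>. Being a maximum of functions linear
  in \<open>(A,B)\<close>, \<open>F\<^sub>t\<close> is subadditive; and inserting \<open>X = \<Sum>k. M\<^sub>k \<otimes> X\<^sub>k\<close> together with the
  Kadison--Schwarz inequality gives \<open>F\<^sub>t(\<rho>,\<sigma>) \<ge> \<Sum>k. F\<^sub>t(R\<^sub>k,S\<^sub>k)\<close>.\<close>

section \<open>Spectral theorem for Hermitian matrices\<close>

definition cinner :: "('a::finite \<Rightarrow> complex) \<Rightarrow> ('a \<Rightarrow> complex) \<Rightarrow> complex" where
  "cinner v w = (\<Sum>i\<in>UNIV. cnj (v i) * w i)"

definition mv :: "('a::finite) cmat \<Rightarrow> ('a \<Rightarrow> complex) \<Rightarrow> 'a \<Rightarrow> complex" where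
  "mv A v = (\<lambda>i. \<Sum>j\<in>UNIV. A i j * v j)"

definition adj :: "'a cmat \<Rightarrow> 'a cmat" where
  "adj A = (\<lambda>i j. cnj (A j i))"

lemma cinner_commute: "cinner w v = cnj (cinner v w)"
  by (simp add: cinner_def mult.commute)

lemma cinner_self: "cinner v v = of_real (\<Sum>i\<in>UNIV. (cmod (v i))\<^sup>2)"
  by (simp add: cinner_def complex_norm_square mult.commute del: of_real_power)

lemma cinner_self_eq_0: "cinner v v = 0 \<Longrightarrow> v i = 0"
  unfolding cinner_self of_real_eq_0_iff by (subst (asm) sum_nonneg_eq_0_iff) auto

lemma Re_cinner_self_nonneg: "0 \<le> Re (cinner v v)"
  by (simp add: cinner_self sum_nonneg)

lemma cinner_diff_right: "cinner v (\<lambda>i. w i - z i) = cinner v w - cinner v z"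
  by (simp add: cinner_def algebra_simps sum_subtractf)

lemma cinner_diff_left: "cinner (\<lambda>i. w i - z i) v = cinner w v - cinner z v"
  by (simp add: cinner_def algebra_simps sum_subtractf)

lemma cinner_scale_right: "cinner v (\<lambda>i. c * w i) = c * cinner v w"
  by (simp add: cinner_def sum_distrib_left mult_ac)

lemma cinner_scale_left: "cinner (\<lambda>i. c * w i) v = cnj c * cinner w v"
  by (simp add: cinner_def sum_distrib_left mult_ac)

lemma cinner_sum_right: "cinner v (\<lambda>i. \<Sum>k\<in>K. w k i) = (\<Sum>k\<in>K. cinner v (w k))"
  unfolding cinner_def sum_distrib_left by (rule sum.swap)

lemma cinner_mv: "cinner v (mv A w) = cinner (mv (adj A) v) w"
  by (simp add: cinner_def mv_def adj_def sum_distrib_left sum_distrib_right mult_ac)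
     (rule sum.swap)

lemma mv_diff: "mv A (\<lambda>i. v i - w i) = (\<lambda>i. mv A v i - mv A w i)"
  by (simp add: mv_def algebra_simps sum_subtractf)

lemma mv_scale: "mv A (\<lambda>i. c * v i) = (\<lambda>i. c * mv A v i)"
  by (simp add: mv_def sum_distrib_left mult_ac)

lemma mv_mmult: "mv (mmult A B) v = mv A (mv B v)"
  by (rule ext) (simp add: mv_def mmult_def sum_distrib_left sum_distrib_right mult_ac,
    rule sum.swap)

lemma adj_adj [simp]: "adj (adj A) = A"
  by (simp add: adj_def)

lemma adj_mmult: "adj (mmult A B) = mmult (adj B) (adj A)"
  by (simp add: adj_def mmult_def mult_ac)

lemma hermitian_adj: "hermitian A \<longleftrightarrow> adj A = A"
  unfolding hermitian_def adj_def fun_eq_iff by metis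

lemma positive_iff:
  "positive A \<longleftrightarrow> adj A = A \<and> (\<forall>v. 0 \<le> Re (cinner v (mv A v)))"
  unfolding positive_def hermitian_adj cinner_def mv_def sum_distrib_left mult.assoc ..

lemma supp_le_iff:
  "supp_le A B \<longleftrightarrow> (\<forall>v. mv B v = (\<lambda>_. 0) \<longrightarrow> mv A v = (\<lambda>_. 0))"
  by (simp add: supp_le_def mv_def fun_eq_iff)

lemma cinner_self_mv_real:
  assumes "adj A = A" shows "cinner v (mv A v) = of_real (Re (cinner v (mv A v)))"
proof -
  have "cnj (cinner v (mv A v)) = cinner v (mv A v)"
    by (metis cinner_commute cinner_mv assms)
  then show ?thesis by (simp add: complex_eq_iff)
qed

text \<open>For an orthonormal family this is the projection onto the orthogonal complement of its
  span.\<close>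

definition cproj :: "('k \<Rightarrow> 'a \<Rightarrow> complex) \<Rightarrow> 'k set \<Rightarrow> 'a cmat" where
  "cproj u K = (\<lambda>i j. (if i = j then 1 else 0) - (\<Sum>k\<in>K. u k i * cnj (u k j)))"

text \<open>The trace of the complementary projection decides whether an orthonormal family is complete;
  this replaces any appeal to dimension theory.\<close>

lemma orthonormal_complement:
  fixes u :: "'k \<Rightarrow> 'a::finite \<Rightarrow> complex"
  assumes fin: "finite K"
    and orth: "\<And>k l. k \<in> K \<Longrightarrow> l \<in> K \<Longrightarrow> cinner (u k) (u l) = (if k = l then 1 else 0)"
  defines "D \<equiv> cproj u K"
  shows "\<And>k j. k \<in> K \<Longrightarrow> cinner (u k) (\<lambda>i. D i j) = 0"
    and "\<And>j. cinner (\<lambda>i. D i j) (\<lambda>i. D i j) = D j j"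
    and "(\<Sum>j\<in>UNIV. D j j) = of_nat (CARD('a)) - of_nat (card K)"
proof -
  have delta: "cinner v (\<lambda>i. if i = j then 1 else 0) = cnj (v j)" for v :: "'a \<Rightarrow> complex" and j
    by (simp add: cinner_def if_distrib cong: if_cong)
  have perp: "cinner (u k) (\<lambda>i. D i j) = 0" if "k \<in> K" for k j
  proof -
    have "cinner (u k) (\<lambda>i. D i j)
        = cnj (u k j) - (\<Sum>l\<in>K. cinner (u k) (\<lambda>i. cnj (u l j) * u l i))"
      by (simp add: D_def cproj_def cinner_diff_right delta cinner_sum_right mult.commute)
    also have "\<dots> = cnj (u k j) - (\<Sum>l\<in>K. if k = l then cnj (u l j) else 0)"
      using that by (simp add: cinner_scale_right orth if_distrib cong: sum.cong if_cong)
    also have "\<dots> = 0" using that fin by simp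
    finally show ?thesis .
  qed
  show "\<And>k j. k \<in> K \<Longrightarrow> cinner (u k) (\<lambda>i. D i j) = 0" by (rule perp)
  show "cinner (\<lambda>i. D i j) (\<lambda>i. D i j) = D j j" for j
  proof -
    have "cinner (\<lambda>i. D i j) (\<lambda>i. D i j) = cinner (\<lambda>i. D i j) (\<lambda>i. if i = j then 1 else 0)
        - (\<Sum>k\<in>K. cinner (\<lambda>i. D i j) (\<lambda>i. cnj (u k j) * u k i))"
      by (subst (2) D_def, subst (1) cproj_def) (simp add: cinner_diff_right cinner_sum_right mult.commute)
    also have "(\<Sum>k\<in>K. cinner (\<lambda>i. D i j) (\<lambda>i. cnj (u k j) * u k i)) = 0"
      by (intro sum.neutral ballI)
         (simp add: cinner_scale_right cinner_commute[of "\<lambda>i. D i j"] perp)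
    finally show ?thesis by (simp add: delta) (simp add: D_def cproj_def mult.commute)
  qed
  have "(\<Sum>j\<in>UNIV. \<Sum>k\<in>K. u k j * cnj (u k j)) = (\<Sum>k\<in>K. cinner (u k) (u k))"
    by (subst sum.swap) (simp add: cinner_def mult.commute)
  also have "\<dots> = of_nat (card K)" by (simp add: orth)
  finally show "(\<Sum>j\<in>UNIV. D j j) = of_nat (CARD('a)) - of_nat (card K)"
    by (simp add: D_def cproj_def sum_subtractf)
qed

definition onb :: "('a::finite \<Rightarrow> 'a \<Rightarrow> complex) \<Rightarrow> bool" where
  "onb u \<longleftrightarrow> (\<forall>k l. cinner (u k) (u l) = (if k = l then 1 else 0))"

text \<open>The complementary projection \<open>D\<close> has trace
  \<open>CARD('a) - CARD('a) = 0\<close>. Its diagonal entries are the squared norms of its columns,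
  so every column vanishes.\<close>

lemma onb_complete:
  assumes "onb u"
  shows "(\<Sum>k\<in>UNIV. u k i * cnj (u k j)) = (if i = j then 1 else 0)"
proof -
  define D where "D = cproj u UNIV"
  note c = orthonormal_complement[of UNIV u, folded D_def]
  have o: "cinner (u k) (u l) = (if k = l then 1 else 0)" for k l
    using assms by (simp add: onb_def)
  have c2: "cinner (\<lambda>i. D i j) (\<lambda>i. D i j) = D j j" for j using c(2) o by auto
  have "(\<Sum>j\<in>UNIV. D j j) = 0" using c(3) o by simp
  then have "(\<Sum>j\<in>UNIV. Re (D j j)) = 0" by (metis Re_sum zero_complex.sel(1))
  moreover have nn: "0 \<le> Re (D j j)" for j by (metis c2 Re_cinner_self_nonneg)
  ultimately have "Re (D j j) = 0" by (subst (asm) sum_nonneg_eq_0_iff) auto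
  then have "cinner (\<lambda>i. D i j) (\<lambda>i. D i j) = 0"
    by (metis c2 cinner_self Re_complex_of_real of_real_0)
  then have "D i j = 0" by (rule cinner_self_eq_0)
  then show ?thesis by (simp add: D_def cproj_def)
qed

lemma onb_expand:
  assumes "onb u"
  shows "cinner v w = (\<Sum>k\<in>UNIV. cinner v (u k) * cinner (u k) w)"
proof -
  have "(\<Sum>k\<in>UNIV. cinner v (u k) * cinner (u k) w)
      = (\<Sum>k\<in>UNIV. \<Sum>i\<in>UNIV. \<Sum>j\<in>UNIV. cnj (v i) * w j * (u k i * cnj (u k j)))"
    unfolding cinner_def sum_product by (simp add: mult_ac)
  also have "\<dots> = (\<Sum>i\<in>UNIV. \<Sum>j\<in>UNIV. \<Sum>k\<in>UNIV. cnj (v i) * w j * (u k i * cnj (u k j)))"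
    by (subst sum.swap, rule sum.cong[OF refl], rule sum.swap)
  also have "\<dots> = (\<Sum>i\<in>UNIV. \<Sum>j\<in>UNIV. cnj (v i) * w j * (if i = j then 1 else 0))"
    by (simp only: sum_distrib_left[symmetric] onb_complete[OF assms])
  also have "\<dots> = cinner v w" by (simp add: cinner_def if_distrib cong: if_cong)
  finally show ?thesis by simp
qed

lemma onb_parseval:
  assumes "onb u"
  shows "cinner v v = of_real (\<Sum>k\<in>UNIV. (cmod (cinner (u k) v))\<^sup>2)"
  unfolding onb_expand[OF assms, of v v]
  by (simp add: cinner_commute[of v] complex_norm_square mult.commute del: of_real_power)

text \<open>The unit vectors orthogonal to the given eigenvectors form a nonempty compact set. A
  maximiser of the quadratic form of \<open>A\<close> there is an eigenvector, since otherwise a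
  small perturbation would increase the form.\<close>

lemma hermitian_eigenvector_in_complement:
  fixes A :: "('a::finite) cmat" and u :: "'k \<Rightarrow> 'a \<Rightarrow> complex"
  assumes A: "adj A = A" and fin: "finite K" and card: "card K < CARD('a)"
    and orth: "\<And>k l. k \<in> K \<Longrightarrow> l \<in> K \<Longrightarrow> cinner (u k) (u l) = (if k = l then 1 else 0)"
    and eig: "\<And>k. k \<in> K \<Longrightarrow> mv A (u k) = (\<lambda>i. of_real (r k) * u k i)"
  obtains v c where "cinner v v = 1" "\<And>k. k \<in> K \<Longrightarrow> cinner (u k) v = 0"
    "mv A v = (\<lambda>i. of_real c * v i)"
proof -
  \<comment> \<open>Vectors are moved to \<open>complex^'a\<close>, where the norm and compactness
    of the unit sphere are available.\<close>
  define V where "V = {v :: complex^'a. norm v = 1 \<and> (\<forall>k\<in>K. cinner (u k) (\<lambda>i. v $ i) = 0)}"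
  have norm: "cinner (\<lambda>i. v $ i) (\<lambda>i. v $ i) = of_real ((norm v)\<^sup>2)" for v :: "complex^'a"
    by (simp add: cinner_self norm_vec_def L2_set_def sum_nonneg)
  have cont: "continuous_on S (\<lambda>v. v $ i)" for S :: "(complex^'a) set" and i
    by (auto simp: continuous_on_def intro: tendsto_vec_nth)
  have V_scale: "\<exists>x\<in>V. \<exists>c>0. w = (\<lambda>i. of_real c * x $ i)"
    if w: "\<And>k. k \<in> K \<Longrightarrow> cinner (u k) w = 0" and nz: "w \<noteq> (\<lambda>_. 0)" for w
  proof -
    define x where "x = (\<chi> i. w i)"
    have "x \<noteq> 0" using nz by (auto simp: x_def vec_eq_iff)
    then have n: "norm x > 0" by simp
    define y where "y = (1 / norm x) *\<^sub>R x"
    have yi: "(\<lambda>i. y $ i) = (\<lambda>i. of_real (1 / norm x) * w i)"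
      by (simp add: y_def x_def) (simp add: scaleR_conv_of_real)
    have "y \<in> V" unfolding V_def mem_Collect_eq yi cinner_scale_right using w n
      by (simp add: y_def)
    moreover have "w = (\<lambda>i. of_real (norm x) * y $ i)"
      using n by (simp add: yi[unfolded fun_eq_iff])
    ultimately show ?thesis using n by blast
  qed
  have "V \<noteq> {}"
  proof -
    \<comment> \<open>The columns of \<open>D\<close> lie in the complement, and its trace
      \<open>CARD('a) - card K\<close> is nonzero, so some column is nonzero.\<close>
    define D where "D = cproj u K"
    note c = orthonormal_complement[of K u, OF fin orth, folded D_def]
    have "(\<Sum>j\<in>UNIV. D j j) \<noteq> 0" using c(3) card by simp
    then obtain j where "D j j \<noteq> 0" by (meson sum.neutral)
    then have "(\<lambda>i. D i j) \<noteq> (\<lambda>_. 0)" by metis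
    from V_scale[OF c(1) this] show ?thesis by blast
  qed
  moreover have "compact V"
  proof -
    have "closed {v :: complex^'a. \<forall>k\<in>K. cinner (u k) (\<lambda>i. v $ i) = 0}"
      unfolding cinner_def Collect_ball_eq
      by (intro closed_INT ballI closed_Collect_eq continuous_intros cont)
    then have "compact (sphere 0 1 \<inter> {v :: complex^'a. \<forall>k\<in>K. cinner (u k) (\<lambda>i. v $ i) = 0})"
      by (intro compact_Int_closed) auto
    also have "sphere 0 1 \<inter> {v :: complex^'a. \<forall>k\<in>K. cinner (u k) (\<lambda>i. v $ i) = 0} = V"
      by (auto simp: V_def)
    finally show ?thesis .
  qed
  moreover have "continuous_on V (\<lambda>v. Re (cinner (\<lambda>i. v $ i) (mv A (\<lambda>i. v $ i))))"
    unfolding cinner_def mv_def by (intro continuous_intros cont)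
  ultimately obtain x where x: "x \<in> V" and
    max: "\<And>y. y \<in> V \<Longrightarrow> Re (cinner (\<lambda>i. y $ i) (mv A (\<lambda>i. y $ i)))
                     \<le> Re (cinner (\<lambda>i. x $ i) (mv A (\<lambda>i. x $ i)))"
    using continuous_attains_sup[of V "\<lambda>v. Re (cinner (\<lambda>i. v $ i) (mv A (\<lambda>i. v $ i)))"] by blast
  define v where "v = (\<lambda>i. x $ i)"
  define c where "c = Re (cinner v (mv A v))"
  \<comment> \<open>Maximality of \<open>c\<close> says that \<open>B\<close> has a nonnegative
    quadratic form on the complement, and that form vanishes at \<open>v\<close>.\<close>
  define B where "B w = (\<lambda>i. of_real c * w i - mv A w i)" for w
  have v1: "cinner v v = 1" and vK: "\<And>k. k \<in> K \<Longrightarrow> cinner (u k) v = 0"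
    using x norm[of x] by (auto simp: V_def v_def)
  have B_pos: "0 \<le> Re (cinner w (B w))" if w: "\<And>k. k \<in> K \<Longrightarrow> cinner (u k) w = 0" for w
  proof (cases "w = (\<lambda>_. 0)")
    case True
    then show ?thesis by (simp add: cinner_def)
  next
    case False
    from V_scale[OF w this] obtain y a where y: "y \<in> V" and a: "a > 0"
      and wy: "w = (\<lambda>i. of_real a * y $ i)" by blast
    have "cinner w (B w) = of_real (a\<^sup>2) * (of_real c * cinner (\<lambda>i. y $ i) (\<lambda>i. y $ i)
           - cinner (\<lambda>i. y $ i) (mv A (\<lambda>i. y $ i)))"
      unfolding B_def wy cinner_diff_right mv_scale cinner_scale_right cinner_scale_left
      by (simp add: algebra_simps power2_eq_square)
    moreover have "cinner (\<lambda>i. y $ i) (\<lambda>i. y $ i) = 1" using y norm[of y] by (simp add: V_def)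
    ultimately have "Re (cinner w (B w)) = a\<^sup>2 * (c - Re (cinner (\<lambda>i. y $ i) (mv A (\<lambda>i. y $ i))))"
      by simp
    then show ?thesis using max[OF y] by (simp add: c_def v_def)
  qed
  \<comment> \<open>The residual of the eigenvalue equation. It stays in the complement because
    \<open>B\<close> is self-adjoint and maps each \<open>u k\<close> to a multiple of
    itself.\<close>
  define z where "z = B v"
  have Bsym: "cinner p (B q) = cinner (B p) q" for p q
    unfolding B_def cinner_diff_right cinner_diff_left cinner_scale_left cinner_scale_right
      cinner_mv A by simp
  have uB: "cinner (u k) (B v) = 0" if "k \<in> K" for k
  proof -
    have "B (u k) = (\<lambda>i. of_real (c - r k) * u k i)"
      by (simp add: B_def eig[OF that] algebra_simps)
    then show ?thesis using vK[OF that] by (simp add: Bsym cinner_scale_left)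
  qed
  have vBv: "cinner v (B v) = 0"
    unfolding B_def cinner_diff_right cinner_scale_right v1
    using cinner_self_mv_real[OF A, of v] by (simp add: c_def)
  have "Re (cinner z z) \<le> 0"
  proof (rule ccontr)
    assume "\<not> Re (cinner z z) \<le> 0"
    define a where "a = Re (cinner z z)"
    define b where "b = Re (cinner z (B z))"
    have a: "a > 0" using \<open>\<not> Re (cinner z z) \<le> 0\<close> by (simp add: a_def)
    \<comment> \<open>This step size gives \<open>e * b \<le> a\<close> whatever the sign of
      \<open>b\<close>, so the form of \<open>B\<close> at \<open>v - e z\<close>, which is
      \<open>e * (e * b - 2 * a)\<close>, would be negative.\<close>
    define e where "e = a / (\<bar>b\<bar> + 1)"
    have e: "e > 0" using a by (simp add: e_def add_nonneg_pos)
    have "e * b \<le> e * (\<bar>b\<bar> + 1)" using e by (intro mult_left_mono) auto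
    also have "\<dots> = a" using abs_ge_zero[of b] by (simp add: e_def)
    finally have eb: "e * b \<le> a" .
    define w where "w = (\<lambda>i. v i - of_real e * z i)"
    have Bw: "B w = (\<lambda>i. B v i - of_real e * B z i)"
      unfolding B_def w_def mv_diff mv_scale by (simp add: algebra_simps)
    have "Re (cinner w (B w)) = - 2 * e * a + e\<^sup>2 * b"
      unfolding Bw
      unfolding w_def cinner_diff_right cinner_diff_left cinner_scale_right cinner_scale_left
        vBv Bsym[of v z] z_def[symmetric]
      by (simp add: a_def b_def vBv[folded z_def] power2_eq_square algebra_simps)
    moreover have "cinner (u k) w = 0" if "k \<in> K" for k
      unfolding w_def cinner_diff_right cinner_scale_right z_def using vK[OF that] uB[OF that] by simp
    ultimately have "0 \<le> - 2 * e * a + e\<^sup>2 * b" using B_pos by metis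
    also have "\<dots> = e * (e * b - 2 * a)" by (simp add: power2_eq_square algebra_simps)
    also have "\<dots> < 0" using e eb a by (intro mult_pos_neg) auto
    finally show False by simp
  qed
  then have "cinner z z = 0"
    using Re_cinner_self_nonneg[of z] by (simp add: cinner_self)
  then have "mv A v = (\<lambda>i. of_real c * v i)"
    using cinner_self_eq_0[of z] by (simp add: z_def B_def fun_eq_iff)
  with v1 vK that show thesis by blast
qed

text \<open>Induction over subsets of the index type adds one orthonormal eigenvector at a time,
  until the family is indexed by the whole type.\<close>

lemma hermitian_spectral_decomp:
  fixes A :: "('a::finite) cmat"
  assumes A: "adj A = A"
  shows "\<exists>d. spectral_decomp A d"
proof -
  have "\<exists>u r. (\<forall>k\<in>K. \<forall>l\<in>K. cinner (u k) (u l) = (if k = l then 1 else 0)) \<and>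
      (\<forall>k\<in>K. mv A (u k) = (\<lambda>i. of_real (r k) * u k i))" if "finite K" for K :: "'a set"
    using that
  proof (induction K)
    case empty
    show ?case by simp
  next
    case (insert k0 K)
    then obtain u r where
      o: "\<And>k l. k \<in> K \<Longrightarrow> l \<in> K \<Longrightarrow> cinner (u k) (u l) = (if k = l then 1 else 0)" and
      e: "\<And>k. k \<in> K \<Longrightarrow> mv A (u k) = (\<lambda>i. of_real (r k) * u k i)" by metis
    have "card K < CARD('a)" using insert by (intro psubset_card_mono) auto
    from hermitian_eigenvector_in_complement[OF A \<open>finite K\<close> this o e]
    obtain v c where v: "cinner v v = 1" "\<And>k. k \<in> K \<Longrightarrow> cinner (u k) v = 0"
      "mv A v = (\<lambda>i. of_real c * v i)" by metis
    have v': "cinner v (u k) = 0" if "k \<in> K" for k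
      using v(2)[OF that] cinner_commute[of v "u k"] by simp
    have ne: "k \<noteq> k0" if "k \<in> K" for k using insert that by auto
    have "cinner ((u(k0 := v)) k) ((u(k0 := v)) l) = (if k = l then 1 else 0)"
      if "k \<in> insert k0 K" "l \<in> insert k0 K" for k l
      using that ne v v' o by auto
    moreover have "mv A ((u(k0 := v)) k) = (\<lambda>i. of_real ((r(k0 := c)) k) * (u(k0 := v)) k i)"
      if "k \<in> insert k0 K" for k
      using that ne v e by auto
    ultimately show ?case by blast
  qed
  from this[of UNIV] obtain u r where
    o: "onb u" and e: "\<And>k. mv A (u k) = (\<lambda>i. of_real (r k) * u k i)"
    by (auto simp: onb_def)
  have "A i j = (\<Sum>k\<in>UNIV. of_real (r k) * u k i * cnj (u k j))" for i j
  proof -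
    \<comment> \<open>Completeness of the eigenbasis inserts the identity to the right of
      \<open>A\<close>.\<close>
    have "A i j = (\<Sum>l\<in>UNIV. A i l * (\<Sum>k\<in>UNIV. u k l * cnj (u k j)))"
      by (simp add: onb_complete[OF o] if_distrib cong: if_cong)
    also have "\<dots> = (\<Sum>k\<in>UNIV. mv A (u k) i * cnj (u k j))"
      by (simp add: mv_def sum_distrib_left sum_distrib_right mult_ac) (rule sum.swap)
    finally show ?thesis by (simp add: e)
  qed
  then have "spectral_decomp A (r, u)"
    using o by (simp add: spectral_decomp_def onb_def cinner_def)
  then show ?thesis ..
qed

section \<open>Matrix algebra, positivity and traces in an eigenbasis\<close>

lemma mmult_assoc: "mmult (mmult A B) C = mmult A (mmult B C)"
  unfolding mmult_def sum_distrib_left sum_distrib_right mult.assoc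
  by (intro ext) (rule sum.swap)

lemma trace_mmult_commute: "trace (mmult A B) = trace (mmult B A)"
  unfolding trace_def mmult_def by (subst sum.swap) (simp add: mult.commute)

lemma mmult_idm_right [simp]: "mmult A idm = A"
  by (simp add: mmult_def idm_def if_distrib cong: if_cong)

lemma mmult_idm_left [simp]: "mmult idm A = A"
proof (intro ext)
  fix i j
  have "mmult idm A i j = (\<Sum>k\<in>UNIV. if i = k then A k j else 0)"
    unfolding mmult_def idm_def by (rule sum.cong) auto
  then show "mmult idm A i j = A i j" by simp
qed

lemma mv_idm [simp]: "mv idm v = v"
proof
  fix i
  have "mv idm v i = (\<Sum>k\<in>UNIV. if i = k then v k else 0)"
    unfolding mv_def idm_def by (rule sum.cong) auto
  then show "mv idm v i = v i" by simp
qed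

lemma spectral_decomp_onb: "spectral_decomp A (r, u) \<Longrightarrow> onb u"
  by (simp add: spectral_decomp_def onb_def cinner_def)

lemma onb_cinner: "onb u \<Longrightarrow> cinner (u k) (u l) = (if k = l then 1 else 0)"
  by (simp add: onb_def)

lemma spectral_decomp_entry:
  "spectral_decomp A (r, u) \<Longrightarrow> A i j = (\<Sum>k\<in>UNIV. of_real (r k) * u k i * cnj (u k j))"
  by (simp add: spectral_decomp_def)

lemma spectral_decomp_mv:
  assumes "spectral_decomp A (r, u)"
  shows "mv A v i = (\<Sum>k\<in>UNIV. of_real (r k) * cinner (u k) v * u k i)"
  unfolding mv_def cinner_def spectral_decomp_entry[OF assms] sum_distrib_left sum_distrib_right
  by (subst sum.swap) (simp add: mult_ac)

lemma spectral_decomp_eigen: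
  assumes "spectral_decomp A (r, u)"
  shows "mv A (u k) = (\<lambda>i. of_real (r k) * u k i)"
proof
  fix i
  have "mv A (u k) i = (\<Sum>l\<in>UNIV. if l = k then of_real (r k) * u k i else 0)"
    unfolding spectral_decomp_mv[OF assms] using spectral_decomp_onb[OF assms]
    by (intro sum.cong) (auto simp: onb_def)
  then show "mv A (u k) i = of_real (r k) * u k i" by simp
qed

lemma spectral_decomp_quadratic:
  assumes "spectral_decomp A (r, u)"
  shows "cinner v (mv A v) = of_real (\<Sum>k\<in>UNIV. r k * (cmod (cinner (u k) v))\<^sup>2)"
proof -
  have "cinner v (mv A v) = cinner v (\<lambda>i. \<Sum>k\<in>UNIV. of_real (r k) * cinner (u k) v * u k i)"
    by (rule arg_cong[of _ _ "cinner v"]) (rule ext, rule spectral_decomp_mv[OF assms])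
  also have "\<dots> = (\<Sum>k\<in>UNIV. of_real (r k) * (cinner (u k) v * cnj (cinner (u k) v)))"
    unfolding cinner_sum_right cinner_scale_right cinner_commute[of v "u _"] by (simp add: mult_ac)
  finally show ?thesis by (simp add: complex_norm_square[symmetric])
qed

lemma trace_spectral_decomp:
  assumes "spectral_decomp A (r, u)"
  shows "trace (mmult A X) = (\<Sum>k\<in>UNIV. of_real (r k) * cinner (u k) (mv X (u k)))"
proof -
  have "trace (mmult A X) = (\<Sum>i\<in>UNIV. \<Sum>j\<in>UNIV. \<Sum>k\<in>UNIV. of_real (r k) * u k i * cnj (u k j) * X j i)"
    unfolding trace_def mmult_def spectral_decomp_entry[OF assms] sum_distrib_right ..
  also have "\<dots> = (\<Sum>k\<in>UNIV. \<Sum>j\<in>UNIV. \<Sum>i\<in>UNIV. of_real (r k) * u k i * cnj (u k j) * X j i)"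
    by (subst sum.swap, subst sum.swap[of _ UNIV UNIV], subst (2) sum.swap)
       (subst sum.swap, rule sum.cong[OF refl], rule sum.swap)
  also have "\<dots> = (\<Sum>k\<in>UNIV. of_real (r k) * cinner (u k) (mv X (u k)))"
    by (simp add: cinner_def mv_def sum_distrib_left mult_ac)
  finally show ?thesis .
qed

lemma spectral_decomp_trace:
  assumes "spectral_decomp A (r, u)"
  shows "trace A = of_real (\<Sum>k\<in>UNIV. r k)"
  using trace_spectral_decomp[OF assms, of idm] spectral_decomp_onb[OF assms]
  by (simp add: onb_def)

lemma positive_spectral_decomp: "positive A \<Longrightarrow> \<exists>d. spectral_decomp A d"
  unfolding positive_iff using hermitian_spectral_decomp by blast

lemma positive_eigenvalue_nonneg:
  assumes "positive A" "spectral_decomp A (r, u)"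
  shows "0 \<le> r k"
proof -
  have "0 \<le> Re (cinner (u k) (mv A (u k)))" using assms by (simp add: positive_iff)
  also have "\<dots> = r k"
    unfolding spectral_decomp_eigen[OF assms(2)] cinner_scale_right
    using spectral_decomp_onb[OF assms(2)] by (simp add: onb_def)
  finally show ?thesis .
qed

text \<open>In an eigenbasis the quadratic form is a sum of nonnegative terms. If it vanishes, each
  term does, and with it each component of \<open>mv A v\<close>.\<close>

lemma positive_null_vector:
  assumes "positive A" "Re (cinner v (mv A v)) = 0"
  shows "mv A v = (\<lambda>_. 0)"
proof -
  obtain r u where d: "spectral_decomp A (r, u)" using positive_spectral_decomp[OF assms(1)] by auto
  have r: "0 \<le> r k" for k by (rule positive_eigenvalue_nonneg[OF assms(1) d])
  have "(\<Sum>k\<in>UNIV. r k * (cmod (cinner (u k) v))\<^sup>2) = 0"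
    using assms(2) by (simp only: spectral_decomp_quadratic[OF d] Re_complex_of_real)
  then have "r k * (cmod (cinner (u k) v))\<^sup>2 = 0" for k
    using r by (subst (asm) sum_nonneg_eq_0_iff) auto
  then have z: "of_real (r k) * cinner (u k) v = 0" for k by simp
  show ?thesis by (intro ext) (simp only: spectral_decomp_mv[OF d] z mult_zero_left sum.neutral_const)
qed

lemma positive_trace_mmult_nonneg:
  assumes "positive A" "positive B"
  shows "0 \<le> Re (trace (mmult A B))"
proof -
  obtain r u where d: "spectral_decomp A (r, u)" using positive_spectral_decomp[OF assms(1)] by auto
  have "0 \<le> r k" for k by (rule positive_eigenvalue_nonneg[OF assms(1) d])
  then show ?thesis using assms(2)
    by (simp add: trace_spectral_decomp[OF d] positive_iff sum_nonneg)
qed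

text \<open>Extends the kernel inclusion from vectors to positive operators \<open>N\<close>: each
  eigenvector of \<open>N\<close> with nonzero eigenvalue lies in the kernel of \<open>B\<close>,
  hence in that of \<open>A\<close>.\<close>

lemma supp_le_trace_eq_0:
  assumes "supp_le A B" "positive B" "positive N" "Re (trace (mmult B N)) = 0"
  shows "trace (mmult A N) = 0"
proof -
  obtain n x where d: "spectral_decomp N (n, x)" using positive_spectral_decomp[OF assms(3)] by auto
  have n: "0 \<le> n k" for k by (rule positive_eigenvalue_nonneg[OF assms(3) d])
  have "(\<Sum>k\<in>UNIV. n k * Re (cinner (x k) (mv B (x k)))) = 0"
    using assms(4) unfolding trace_mmult_commute[of B] trace_spectral_decomp[OF d] by simp
  then have z: "n k * Re (cinner (x k) (mv B (x k))) = 0" for k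
    using n assms(2) by (subst (asm) sum_nonneg_eq_0_iff) (auto simp: positive_iff)
  have "of_real (n k) * cinner (x k) (mv A (x k)) = 0" for k
  proof (cases "n k = 0")
    case False
    then have "mv B (x k) = (\<lambda>_. 0)" using z[of k] by (intro positive_null_vector assms) simp
    then have "mv A (x k) = (\<lambda>_. 0)" using assms(1) by (simp add: supp_le_iff)
    then show ?thesis by (simp add: cinner_def)
  qed simp
  then show ?thesis
    unfolding trace_mmult_commute[of A] trace_spectral_decomp[OF d] by (simp only: sum.neutral_const)
qed

section \<open>Classical relative entropy through resolvents\<close>

lemma tendsto_ln_affine_diff:
  fixes r s :: real assumes "r > 0" "s \<ge> 0"
  shows "((\<lambda>T. ln (s + T * r) - ln T) \<longlongrightarrow> ln r) at_top"
proof -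
  \<comment> \<open>For large \<open>T\<close> the difference of logarithms is
    \<open>ln (s / T + r)\<close>.\<close>
  have "((\<lambda>T. ln (s / T + r)) \<longlongrightarrow> ln (0 + r)) at_top"
    using assms by (intro tendsto_intros tendsto_divide_0[OF tendsto_const]
        filterlim_at_top_imp_at_infinity filterlim_ident) auto
  moreover have "\<forall>\<^sub>F T in at_top. ln (s / T + r) = ln (s + T * r) - ln T"
    using eventually_gt_at_top[of 0]
  proof eventually_elim
    case (elim T)
    then have "s + T * r > 0" using assms by (simp add: add_nonneg_pos)
    moreover have "s / T + r = (s + T * r) / T" using elim by (simp add: field_simps)
    ultimately show ?case using elim by (simp add: ln_div)
  qed
  ultimately show ?thesis using tendsto_cong by force
qed

text \<open>The integral over \<open>0 \<le> t \<le> T\<close> of \<open>\<Sum>i. p\<^sub>i r\<^sub>i\<^sup>2 / (s\<^sub>i + t r\<^sub>i)\<close>; up to \<open>(\<Sum>i. p\<^sub>i r\<^sub>i) ln T\<close> it tends to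
  the relative entropy as \<open>T\<close> grows.\<close>

definition trunc_entropy :: "('i \<Rightarrow> real) \<Rightarrow> ('i \<Rightarrow> real) \<Rightarrow> ('i \<Rightarrow> real) \<Rightarrow> 'i set \<Rightarrow> real \<Rightarrow> real" where
  "trunc_entropy p r s I T = (\<Sum>i\<in>I. p i * r i * (ln (s i + T * r i) - ln (s i)))"

text \<open>Absolute continuity: no mass \<open>p i * r i\<close> sits where \<open>s i = 0\<close>.
  There the convention \<open>ln 0 = 0\<close> has no effect, because the logarithm is multiplied by
  zero.\<close>

definition admissible :: "('i \<Rightarrow> real) \<Rightarrow> ('i \<Rightarrow> real) \<Rightarrow> ('i \<Rightarrow> real) \<Rightarrow> 'i set \<Rightarrow> bool" where
  "admissible p r s I \<longleftrightarrow> (\<forall>i\<in>I. 0 \<le> r i \<and> 0 \<le> s i \<and> (s i = 0 \<longrightarrow> p i * r i = 0))"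

lemma trunc_entropy_deriv:
  assumes "admissible p r s I" "T \<ge> 0"
  shows "(trunc_entropy p r s I has_real_derivative (\<Sum>i\<in>I. p i * ((r i)\<^sup>2 / (s i + T * r i)))) (at T)"
  unfolding trunc_entropy_def
proof (rule DERIV_sum)
  fix i assume i: "i \<in> I"
  show "((\<lambda>T. p i * r i * (ln (s i + T * r i) - ln (s i)))
     has_real_derivative p i * ((r i)\<^sup>2 / (s i + T * r i))) (at T)"
  proof (cases "p i * r i = 0")
    case True
    then show ?thesis by auto
  next
    case False
    then have "s i > 0" "r i > 0" using assms i unfolding admissible_def by fastforce+
    then have "s i + T * r i > 0" using assms by (simp add: add_pos_nonneg)
    then show ?thesis
      by (auto intro!: derivative_eq_intros simp: power2_eq_square)
  qed
qed

lemma trunc_entropy_0: "trunc_entropy p r s I 0 = 0"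
  by (simp add: trunc_entropy_def)

lemma trunc_entropy_limit:
  assumes "admissible p r s I"
  shows "((\<lambda>T. trunc_entropy p r s I T - (\<Sum>i\<in>I. p i * r i) * ln T)
     \<longlongrightarrow> (\<Sum>i\<in>I. p i * r i * (ln (r i) - ln (s i)))) at_top"
proof -
  have "((\<lambda>T. \<Sum>i\<in>I. p i * r i * ((ln (s i + T * r i) - ln T) - ln (s i)))
     \<longlongrightarrow> (\<Sum>i\<in>I. p i * r i * (ln (r i) - ln (s i)))) at_top"
  proof (rule tendsto_sum)
    fix i assume i: "i \<in> I"
    show "((\<lambda>T. p i * r i * ((ln (s i + T * r i) - ln T) - ln (s i)))
       \<longlongrightarrow> p i * r i * (ln (r i) - ln (s i))) at_top"
    proof (cases "p i * r i = 0")
      case True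
      then show ?thesis by auto
    next
      case False
      then have "s i \<ge> 0" "r i > 0" using assms i unfolding admissible_def by fastforce+
      then show ?thesis by (intro tendsto_intros tendsto_ln_affine_diff)
    qed
  qed
  moreover have "trunc_entropy p r s I T - (\<Sum>i\<in>I. p i * r i) * ln T
      = (\<Sum>i\<in>I. p i * r i * ((ln (s i + T * r i) - ln T) - ln (s i)))" for T
    unfolding trunc_entropy_def sum_distrib_right sum_subtractf[symmetric]
    by (rule sum.cong) (auto simp: algebra_simps)
  ultimately show ?thesis by simp
qed

text \<open>The difference of the two truncated integrals is 0 at \<open>T = 0\<close> and has
  nonnegative derivative by \<open>le\<close>. Equal masses \<open>tr\<close> cancel the divergent
  \<open>ln T\<close> terms, so the limit compares the entropies.\<close>

lemma entropy_le_of_resolvent_le: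
  assumes a: "admissible p r s I" and a': "admissible p' r' s' I'"
    and le: "\<And>t. t > 0 \<Longrightarrow> (\<Sum>i\<in>I. p i * ((r i)\<^sup>2 / (s i + t * r i)))
                       \<le> (\<Sum>i\<in>I'. p' i * ((r' i)\<^sup>2 / (s' i + t * r' i)))"
    and tr: "(\<Sum>i\<in>I. p i * r i) = (\<Sum>i\<in>I'. p' i * r' i)"
  shows "(\<Sum>i\<in>I. p i * r i * (ln (r i) - ln (s i)))
       \<le> (\<Sum>i\<in>I'. p' i * r' i * (ln (r' i) - ln (s' i)))"
proof -
  define f where "f T = trunc_entropy p' r' s' I' T - trunc_entropy p r s I T" for T
  have der: "(f has_real_derivative (\<Sum>i\<in>I'. p' i * ((r' i)\<^sup>2 / (s' i + T * r' i)))
      - (\<Sum>i\<in>I. p i * ((r i)\<^sup>2 / (s i + T * r i)))) (at T)" if "T \<ge> 0" for T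
    unfolding f_def using trunc_entropy_deriv[OF a that] trunc_entropy_deriv[OF a' that]
    by (intro DERIV_diff)
  have f_nonneg: "0 \<le> f T" if "T \<ge> 0" for T
  proof -
    have "f 0 \<le> f T"
    proof (rule DERIV_nonneg_imp_increasing_open[OF that])
      show "\<exists>y. (f has_real_derivative y) (at x) \<and> 0 \<le> y" if "0 < x" for x
        using der[of x] le[OF that] that by (intro exI conjI) auto
      show "continuous_on {0..T} f"
        using der by (intro continuous_at_imp_continuous_on ballI)
          (meson DERIV_isCont atLeastAtMost_iff)
    qed
    then show ?thesis by (simp add: f_def trunc_entropy_0)
  qed
  have "((\<lambda>T. f T) \<longlongrightarrow> (\<Sum>i\<in>I'. p' i * r' i * (ln (r' i) - ln (s' i)))
      - (\<Sum>i\<in>I. p i * r i * (ln (r i) - ln (s i)))) at_top"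
    using tendsto_diff[OF trunc_entropy_limit[OF a'] trunc_entropy_limit[OF a]] by (simp add: f_def tr)
  moreover have "\<forall>\<^sub>F T in at_top. 0 \<le> f T"
    using eventually_ge_at_top[of 0] by eventually_elim (rule f_nonneg)
  ultimately have "0 \<le> (\<Sum>i\<in>I'. p' i * r' i * (ln (r' i) - ln (s' i)))
      - (\<Sum>i\<in>I. p i * r i * (ln (r i) - ln (s i)))"
    by (rule tendsto_lowerbound) simp
  then show ?thesis by simp
qed

text \<open>Gibbs' inequality: \<open>ln x \<le> x - 1\<close> at \<open>x = s i / r i\<close>
  bounds each term below by \<open>p i * (r i - s i)\<close>, and these bounds have nonnegative
  sum.\<close>

lemma entropy_nonneg:
  assumes a: "admissible p r s I" and p: "\<And>i. i \<in> I \<Longrightarrow> 0 \<le> p i"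
    and tr: "(\<Sum>i\<in>I. p i * s i) \<le> (\<Sum>i\<in>I. p i * r i)"
  shows "0 \<le> (\<Sum>i\<in>I. p i * r i * (ln (r i) - ln (s i)))"
proof -
  have "p i * r i - p i * s i \<le> p i * r i * (ln (r i) - ln (s i))" if i: "i \<in> I" for i
  proof (cases "p i * r i = 0")
    case True
    then show ?thesis using a p i by (auto simp: admissible_def)
  next
    case False
    then have s: "s i > 0" and r: "r i > 0" using a i unfolding admissible_def by fastforce+
    have "ln (s i / r i) \<le> s i / r i - 1" using s r by (intro ln_le_minus_one) simp
    then have "ln (s i) - ln (r i) \<le> s i / r i - 1" using s r by (simp add: ln_div)
    then have "r i * (1 - s i / r i) \<le> r i * (ln (r i) - ln (s i))"
      using r by (intro mult_left_mono) auto
    moreover have "r i * (1 - s i / r i) = r i - s i" using r by (simp add: field_simps)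
    ultimately have "r i - s i \<le> r i * (ln (r i) - ln (s i))" by simp
    from mult_left_mono[OF this p[OF i]] show ?thesis by (simp add: algebra_simps)
  qed
  then have "(\<Sum>i\<in>I. p i * r i - p i * s i) \<le> (\<Sum>i\<in>I. p i * r i * (ln (r i) - ln (s i)))"
    by (rule sum_mono)
  then show ?thesis using tr by (simp add: sum_subtractf)
qed

section \<open>Relative entropy in eigenbases\<close>

type_synonym 'a spec = "('a \<Rightarrow> real) \<times> ('a \<Rightarrow> 'a \<Rightarrow> complex)"

text \<open>The Nussbaum--Szkola reduction: in eigenbases of both arguments, quantum relative entropy
  becomes a weighted classical one, the weights being the squared overlaps of eigenvectors.\<close>

definition overlap :: "('a::finite) spec \<Rightarrow> 'a spec \<Rightarrow> 'a \<times> 'a \<Rightarrow> real" where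
  "overlap d e x = (cmod (cinner (snd d (fst x)) (snd e (snd x))))\<^sup>2"

definition spec_admissible :: "('a::finite) spec \<Rightarrow> 'a spec \<Rightarrow> bool" where
  "spec_admissible d e \<longleftrightarrow> admissible (overlap d e) (\<lambda>x. fst d (fst x)) (\<lambda>x. fst e (snd x)) UNIV"

definition spec_entropy :: "('a::finite) spec \<Rightarrow> 'a spec \<Rightarrow> real" where
  "spec_entropy d e = (\<Sum>x\<in>UNIV. overlap d e x * fst d (fst x) * (ln (fst d (fst x)) - ln (fst e (snd x))))"

text \<open>For \<open>t > 0\<close> and positive operators this is \<open>F\<^sub>t\<close> of the
  integral representation, evaluated in eigenbases.\<close>

definition resolvent_form :: "real \<Rightarrow> ('a::finite) spec \<Rightarrow> 'a spec \<Rightarrow> real" where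
  "resolvent_form t d e =
     (\<Sum>x\<in>UNIV. overlap d e x * ((fst d (fst x))\<^sup>2 / (fst e (snd x) + t * fst d (fst x))))"

lemma sum_Times_eq:
  "(\<Sum>y\<in>M \<times> N. f (fst y) (snd y)) = (\<Sum>k\<in>M. \<Sum>x\<in>N. f k x)"
  unfolding sum.cartesian_product by (simp add: case_prod_beta)

lemma sum_UNIV_prod: "(\<Sum>x\<in>UNIV. f (fst x) (snd x)) = (\<Sum>i\<in>UNIV. \<Sum>j\<in>UNIV. f i j)"
  using sum_Times_eq[of f UNIV UNIV] by simp

text \<open>By Parseval the overlaps form a doubly stochastic matrix; this is the row half.\<close>

lemma overlap_sum_right:
  assumes "onb (snd d)" "onb (snd e)"
  shows "(\<Sum>j\<in>UNIV. overlap d e (i, j)) = 1"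
proof -
  have "of_real (\<Sum>j\<in>UNIV. overlap d e (i, j)) = cinner (snd d i) (snd d i)"
    unfolding onb_parseval[OF assms(2)] overlap_def
    by (simp add: cinner_commute[of "snd e _"])
  also have "\<dots> = of_real 1" using assms(1) by (simp add: onb_def)
  finally show ?thesis by (simp only: of_real_eq_iff)
qed

lemma overlap_sum_left:
  assumes "onb (snd d)" "onb (snd e)"
  shows "(\<Sum>i\<in>UNIV. overlap d e (i, j)) = 1"
proof -
  have "of_real (\<Sum>i\<in>UNIV. overlap d e (i, j)) = cinner (snd e j) (snd e j)"
    unfolding onb_parseval[OF assms(1)] overlap_def by simp
  also have "\<dots> = of_real 1" using assms(2) by (simp add: onb_def)
  finally show ?thesis by (simp only: of_real_eq_iff)
qed

lemma overlap_sum_fst: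
  assumes "onb (snd d)" "onb (snd e)"
  shows "(\<Sum>x\<in>UNIV. overlap d e x * f (fst x)) = (\<Sum>i\<in>UNIV. f i)"
proof -
  have "(\<Sum>x\<in>UNIV. overlap d e x * f (fst x)) = (\<Sum>i\<in>UNIV. \<Sum>j\<in>UNIV. overlap d e (i, j) * f i)"
    using sum_UNIV_prod[of "\<lambda>i j. overlap d e (i, j) * f i"] by simp
  then show ?thesis by (simp add: sum_distrib_right[symmetric] overlap_sum_right[OF assms])
qed

lemma overlap_sum_snd:
  assumes "onb (snd d)" "onb (snd e)"
  shows "(\<Sum>x\<in>UNIV. overlap d e x * f (snd x)) = (\<Sum>j\<in>UNIV. f j)"
proof -
  have "(\<Sum>x\<in>UNIV. overlap d e x * f (snd x)) = (\<Sum>i\<in>UNIV. \<Sum>j\<in>UNIV. overlap d e (i, j) * f j)"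
    using sum_UNIV_prod[of "\<lambda>i j. overlap d e (i, j) * f j"] by simp
  also have "\<dots> = (\<Sum>j\<in>UNIV. \<Sum>i\<in>UNIV. overlap d e (i, j) * f j)" by (rule sum.swap)
  finally show ?thesis by (simp add: sum_distrib_right[symmetric] overlap_sum_left[OF assms])
qed

text \<open>An eigenvector \<open>w j\<close> of \<open>B\<close> with eigenvalue 0 is annihilated
  by \<open>A\<close>. Pairing \<open>mv A (w j)\<close> with an eigenvector \<open>u i\<close> of
  \<open>A\<close> then gives zero overlap unless \<open>r i = 0\<close>.\<close>

lemma spec_admissibleI:
  assumes "positive A" "positive B" "supp_le A B" "spectral_decomp A d" "spectral_decomp B e"
  shows "spec_admissible d e"
proof -
  obtain r u s w where de: "d = (r, u)" "e = (s, w)" by force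
  note d = assms(4)[unfolded de] and e = assms(5)[unfolded de]
  have "cinner (u i) (w j) = 0" if "s j = 0" "r i \<noteq> 0" for i j
  proof -
    have "mv B (w j) = (\<lambda>_. 0)" using that by (simp add: spectral_decomp_eigen[OF e])
    then have "mv A (w j) = (\<lambda>_. 0)" using assms(3) by (simp add: supp_le_iff)
    then have "cinner (u i) (mv A (w j)) = 0" by (simp add: cinner_def)
    moreover have "cinner (u i) (mv A (w j)) = of_real (r i) * cinner (u i) (w j)"
      using assms(1) unfolding cinner_mv
      by (simp add: positive_iff spectral_decomp_eigen[OF d] cinner_scale_left)
    ultimately show ?thesis using that by simp
  qed
  moreover have "0 \<le> r i" "0 \<le> s j" for i j
    using positive_eigenvalue_nonneg[OF assms(1) d] positive_eigenvalue_nonneg[OF assms(2) e] by auto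
  ultimately show ?thesis
    by (auto simp: spec_admissible_def admissible_def overlap_def de)
qed

text \<open>\<open>mat_fun\<close> uses a decomposition picked by the choice operator, so
  \<open>d\<close> and \<open>e\<close> are obtained as exactly those choices.\<close>

lemma rel_entropy_eq_spec_entropy:
  fixes A B :: "('a::finite) cmat"
  assumes "positive A" "positive B" "supp_le A B"
  obtains d e where "spectral_decomp A d" "spectral_decomp B e"
    "rel_entropy A B = ereal (spec_entropy d e)"
proof -
  define d where "d = (SOME d. spectral_decomp A d)"
  define e where "e = (SOME d. spectral_decomp B d)"
  have d: "spectral_decomp A d" unfolding d_def by (rule someI_ex[OF positive_spectral_decomp[OF assms(1)]])
  have e: "spectral_decomp B e" unfolding e_def by (rule someI_ex[OF positive_spectral_decomp[OF assms(2)]])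
  obtain r u s w where de: "d = (r, u)" "e = (s, w)" by force
  note d' = d[unfolded de] and e' = e[unfolded de]
  have ou: "onb (snd d)" and ow: "onb (snd e)"
    using spectral_decomp_onb[OF d'] spectral_decomp_onb[OF e'] by (auto simp: de)
  \<comment> \<open>The logarithm keeps the eigenvectors and acts on the eigenvalues.\<close>
  have lA: "spectral_decomp (mat_fun ln A) (\<lambda>k. ln (r k), u)"
  proof -
    have "mat_fun ln A = (\<lambda>i j. \<Sum>k\<in>UNIV. of_real (ln (r k)) * u k i * cnj (u k j))"
      by (simp add: mat_fun_def d_def[symmetric] de Let_def)
    then show ?thesis using d' by (simp add: spectral_decomp_def)
  qed
  have lB: "spectral_decomp (mat_fun ln B) (\<lambda>k. ln (s k), w)"
  proof -
    have "mat_fun ln B = (\<lambda>i j. \<Sum>k\<in>UNIV. of_real (ln (s k)) * w k i * cnj (w k j))"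
      by (simp add: mat_fun_def e_def[symmetric] de Let_def)
    then show ?thesis using e' by (simp add: spectral_decomp_def)
  qed
  have "trace (mmult A (mat_fun ln A)) = of_real (\<Sum>i\<in>UNIV. r i * ln (r i))"
    using ou by (simp add: trace_spectral_decomp[OF d'] spectral_decomp_eigen[OF lA]
        cinner_scale_right de onb_def)
  also have "(\<Sum>i\<in>UNIV. r i * ln (r i)) = (\<Sum>x\<in>UNIV. overlap d e x * (r (fst x) * ln (r (fst x))))"
    using overlap_sum_fst[OF ou ow, of "\<lambda>i. r i * ln (r i)"] by simp
  finally have t1: "trace (mmult A (mat_fun ln A))
      = of_real (\<Sum>x\<in>UNIV. overlap d e x * (r (fst x) * ln (r (fst x))))" .
  have "trace (mmult A (mat_fun ln B))
      = of_real (\<Sum>i\<in>UNIV. \<Sum>j\<in>UNIV. overlap d e (i, j) * (r i * ln (s j)))"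
    by (simp add: trace_spectral_decomp[OF d'] spectral_decomp_quadratic[OF lB] overlap_def de
        cinner_commute[of "w _"] sum_distrib_left mult_ac)
  also have "(\<Sum>i\<in>UNIV. \<Sum>j\<in>UNIV. overlap d e (i, j) * (r i * ln (s j)))
      = (\<Sum>x\<in>UNIV. overlap d e x * (r (fst x) * ln (s (snd x))))"
    using sum_UNIV_prod[of "\<lambda>i j. overlap d e (i, j) * (r i * ln (s j))"] by simp
  finally have t2: "trace (mmult A (mat_fun ln B))
      = of_real (\<Sum>x\<in>UNIV. overlap d e x * (r (fst x) * ln (s (snd x))))" .
  have "Re (trace (mmult A (mat_fun ln A)) - trace (mmult A (mat_fun ln B))) = spec_entropy d e"
    unfolding t1 t2 spec_entropy_def minus_complex.sel Re_complex_of_real sum_subtractf[symmetric]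
    by (rule sum.cong) (auto simp: de algebra_simps)
  then have "rel_entropy A B = ereal (spec_entropy d e)"
    using assms(3) by (simp add: rel_entropy_def)
  with d e that show thesis by blast
qed

lemma spec_entropy_nonneg:
  assumes "onb (snd d)" "onb (snd e)" "spec_admissible d e"
    and "(\<Sum>j\<in>UNIV. fst e j) \<le> (\<Sum>i\<in>UNIV. fst d i)"
  shows "0 \<le> spec_entropy d e"
  unfolding spec_entropy_def
  by (rule entropy_nonneg) (use assms in \<open>auto simp: spec_admissible_def overlap_sum_fst
        overlap_sum_snd, simp add: overlap_def\<close>)

text \<open>Klein's inequality, which later bounds the infimum over \<open>PY\<close> below by
  0.\<close>

lemma rel_entropy_nonneg:
  assumes "density A" "density B"
  shows "0 \<le> rel_entropy A B"
proof (cases "supp_le A B")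
  case True
  have p: "positive A" "positive B" using assms by (auto simp: density_def)
  from rel_entropy_eq_spec_entropy[OF p True] obtain d e where
    d: "spectral_decomp A d" and e: "spectral_decomp B e" and
    eq: "rel_entropy A B = ereal (spec_entropy d e)" by blast
  obtain r u s w where de: "d = (r, u)" "e = (s, w)" by force
  note d' = d[unfolded de] and e' = e[unfolded de]
  have "(\<Sum>k\<in>UNIV. r k) = 1" "(\<Sum>k\<in>UNIV. s k) = 1"
    using assms spectral_decomp_trace[OF d'] spectral_decomp_trace[OF e']
    unfolding density_def by (metis of_real_eq_1_iff)+
  then have "0 \<le> spec_entropy d e"
    using spec_admissibleI[OF p True d e] spectral_decomp_onb[OF d'] spectral_decomp_onb[OF e']
    by (intro spec_entropy_nonneg) (auto simp: de)
  then show ?thesis by (simp add: eq)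
next
  case False
  then show ?thesis by (simp add: rel_entropy_def)
qed

text \<open>A family of entropies is one weighted classical entropy over the disjoint union
  \<open>K \<times> UNIV\<close>. The scalar comparison therefore covers sums on both sides, as both
  entropy inequalities below require.\<close>

lemma spec_entropy_sum_mono:
  fixes d e :: "'k \<Rightarrow> ('a::finite) spec" and d' e' :: "'l \<Rightarrow> ('b::finite) spec"
  assumes adm: "\<And>k. k \<in> K \<Longrightarrow> spec_admissible (d k) (e k)"
    and adm': "\<And>l. l \<in> L \<Longrightarrow> spec_admissible (d' l) (e' l)"
    and onb: "\<And>k. k \<in> K \<Longrightarrow> onb (snd (d k)) \<and> onb (snd (e k))"
    and onb': "\<And>l. l \<in> L \<Longrightarrow> onb (snd (d' l)) \<and> onb (snd (e' l))"
    and tr: "(\<Sum>k\<in>K. \<Sum>i\<in>UNIV. fst (d k) i) = (\<Sum>l\<in>L. \<Sum>i\<in>UNIV. fst (d' l) i)"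
    and le: "\<And>t. t > 0 \<Longrightarrow> (\<Sum>k\<in>K. resolvent_form t (d k) (e k)) \<le> (\<Sum>l\<in>L. resolvent_form t (d' l) (e' l))"
  shows "(\<Sum>k\<in>K. spec_entropy (d k) (e k)) \<le> (\<Sum>l\<in>L. spec_entropy (d' l) (e' l))"
proof -
  have "(\<Sum>y\<in>K \<times> UNIV. overlap (d (fst y)) (e (fst y)) (snd y) * fst (d (fst y)) (fst (snd y))
       * (ln (fst (d (fst y)) (fst (snd y))) - ln (fst (e (fst y)) (snd (snd y)))))
    \<le> (\<Sum>y\<in>L \<times> UNIV. overlap (d' (fst y)) (e' (fst y)) (snd y) * fst (d' (fst y)) (fst (snd y))
       * (ln (fst (d' (fst y)) (fst (snd y))) - ln (fst (e' (fst y)) (snd (snd y)))))"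
  proof (rule entropy_le_of_resolvent_le)
    show "admissible (\<lambda>y. overlap (d (fst y)) (e (fst y)) (snd y)) (\<lambda>y. fst (d (fst y)) (fst (snd y)))
       (\<lambda>y. fst (e (fst y)) (snd (snd y))) (K \<times> UNIV)"
      using adm unfolding admissible_def spec_admissible_def by auto
    show "admissible (\<lambda>y. overlap (d' (fst y)) (e' (fst y)) (snd y)) (\<lambda>y. fst (d' (fst y)) (fst (snd y)))
       (\<lambda>y. fst (e' (fst y)) (snd (snd y))) (L \<times> UNIV)"
      using adm' unfolding admissible_def spec_admissible_def by auto
    show "(\<Sum>y\<in>K \<times> UNIV. overlap (d (fst y)) (e (fst y)) (snd y) * ((fst (d (fst y)) (fst (snd y)))\<^sup>2
          / (fst (e (fst y)) (snd (snd y)) + t * fst (d (fst y)) (fst (snd y)))))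
       \<le> (\<Sum>y\<in>L \<times> UNIV. overlap (d' (fst y)) (e' (fst y)) (snd y) * ((fst (d' (fst y)) (fst (snd y)))\<^sup>2
          / (fst (e' (fst y)) (snd (snd y)) + t * fst (d' (fst y)) (fst (snd y)))))"
      if "t > 0" for t
      using le[OF that] unfolding resolvent_form_def
        sum_Times_eq[where f = "\<lambda>k x. overlap (d k) (e k) x * ((fst (d k) (fst x))\<^sup>2
          / (fst (e k) (snd x) + t * fst (d k) (fst x)))"]
        sum_Times_eq[where f = "\<lambda>k x. overlap (d' k) (e' k) x * ((fst (d' k) (fst x))\<^sup>2
          / (fst (e' k) (snd x) + t * fst (d' k) (fst x)))"] .
    show "(\<Sum>y\<in>K \<times> UNIV. overlap (d (fst y)) (e (fst y)) (snd y) * fst (d (fst y)) (fst (snd y)))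
       = (\<Sum>y\<in>L \<times> UNIV. overlap (d' (fst y)) (e' (fst y)) (snd y) * fst (d' (fst y)) (fst (snd y)))"
      using tr onb onb' unfolding
        sum_Times_eq[where f = "\<lambda>k x. overlap (d k) (e k) x * fst (d k) (fst x)"]
        sum_Times_eq[where f = "\<lambda>k x. overlap (d' k) (e' k) x * fst (d' k) (fst x)"]
      by (simp add: overlap_sum_fst)
  qed
  then show ?thesis unfolding spec_entropy_def
    sum_Times_eq[where f = "\<lambda>k x. overlap (d k) (e k) x * fst (d k) (fst x)
       * (ln (fst (d k) (fst x)) - ln (fst (e k) (snd x)))"]
    sum_Times_eq[where f = "\<lambda>k x. overlap (d' k) (e' k) x * fst (d' k) (fst x)
       * (ln (fst (d' k) (fst x)) - ln (fst (e' k) (snd x)))"] .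
qed

section \<open>Variational formula for the resolvent form\<close>

text \<open>The expression maximised over \<open>X\<close> in \<open>F\<^sub>t\<close>. For fixed
  \<open>X\<close> it is additive in the pair \<open>(A, B)\<close>.\<close>

definition gform :: "real \<Rightarrow> ('a::finite) cmat \<Rightarrow> 'a cmat \<Rightarrow> 'a cmat \<Rightarrow> real" where
  "gform t A B X = 2 * Re (trace (mmult A X)) - Re (trace (mmult B (mmult X (adj X))))
     - t * Re (trace (mmult A (mmult (adj X) X)))"

text \<open>The matrix elements of \<open>X\<close> between the two eigenbases decouple, leaving an
  independent scalar quadratic for each pair of eigenvectors.\<close>

lemma gform_spectral:
  assumes d: "spectral_decomp A (r, u)" and e: "spectral_decomp B (s, w)"
  shows "gform t A B X = (\<Sum>i\<in>UNIV. \<Sum>j\<in>UNIV.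
     2 * r i * Re (cinner (u i) (w j) * cinner (w j) (mv X (u i)))
     - (s j + t * r i) * (cmod (cinner (w j) (mv X (u i))))\<^sup>2)"
proof -
  have ou: "onb u" and ow: "onb w" using spectral_decomp_onb d e by blast+
  have t1: "Re (trace (mmult A X))
      = (\<Sum>i\<in>UNIV. \<Sum>j\<in>UNIV. r i * Re (cinner (u i) (w j) * cinner (w j) (mv X (u i))))"
    unfolding trace_spectral_decomp[OF d] onb_expand[OF ow, of "u _" "mv X _"]
    by (simp add: sum_distrib_left)
  have "Re (trace (mmult B (mmult X (adj X))))
      = (\<Sum>j\<in>UNIV. s j * Re (cinner (mv (adj X) (w j)) (mv (adj X) (w j))))"
    unfolding trace_spectral_decomp[OF e] mv_mmult cinner_mv[of _ X] by simp
  also have "\<dots> = (\<Sum>j\<in>UNIV. \<Sum>i\<in>UNIV. s j * (cmod (cinner (w j) (mv X (u i))))\<^sup>2)"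
    unfolding onb_parseval[OF ou] cinner_mv[of "u _"] adj_adj Re_complex_of_real sum_distrib_left
    by (simp add: cinner_commute[of _ "w _"])
  also have "\<dots> = (\<Sum>i\<in>UNIV. \<Sum>j\<in>UNIV. s j * (cmod (cinner (w j) (mv X (u i))))\<^sup>2)"
    by (rule sum.swap)
  finally have t2: "Re (trace (mmult B (mmult X (adj X))))
      = (\<Sum>i\<in>UNIV. \<Sum>j\<in>UNIV. s j * (cmod (cinner (w j) (mv X (u i))))\<^sup>2)" .
  have "Re (trace (mmult A (mmult (adj X) X)))
      = (\<Sum>i\<in>UNIV. r i * Re (cinner (mv X (u i)) (mv X (u i))))"
    unfolding trace_spectral_decomp[OF d] mv_mmult cinner_mv[of _ "adj X"] adj_adj by simp
  also have "\<dots> = (\<Sum>i\<in>UNIV. \<Sum>j\<in>UNIV. r i * (cmod (cinner (w j) (mv X (u i))))\<^sup>2)"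
    unfolding onb_parseval[OF ow] Re_complex_of_real sum_distrib_left ..
  finally have t3: "Re (trace (mmult A (mmult (adj X) X)))
      = (\<Sum>i\<in>UNIV. \<Sum>j\<in>UNIV. r i * (cmod (cinner (w j) (mv X (u i))))\<^sup>2)" .
  show ?thesis
    unfolding gform_def t1 t2 t3 sum_distrib_left sum_subtractf[symmetric]
    by (intro sum.cong refl) (simp add: algebra_simps)
qed

text \<open>Bound \<open>Re (z * x)\<close> by moduli and complete the square. If
  \<open>m = 0\<close>, then \<open>y = 0\<close> and both sides are 0, because division by zero
  yields 0.\<close>

lemma quadratic_max:
  fixes m y :: real and z x :: complex
  assumes "m \<ge> 0" "m = 0 \<longrightarrow> y = 0"
  shows "2 * y * Re (z * x) - m * (cmod x)\<^sup>2 \<le> (cmod z)\<^sup>2 * (y\<^sup>2 / m)"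
proof (cases "m = 0")
  case False
  then have m: "m > 0" using assms by simp
  have "y * Re (z * x) \<le> \<bar>y\<bar> * \<bar>Re (z * x)\<bar>" by (metis abs_ge_self abs_mult)
  also have "\<dots> \<le> \<bar>y\<bar> * (cmod z * cmod x)"
    using abs_Re_le_cmod[of "z * x"] unfolding norm_mult by (intro mult_left_mono) auto
  finally have "y * Re (z * x) \<le> \<bar>y\<bar> * (cmod z * cmod x)" .
  moreover have "0 \<le> (\<bar>y\<bar> * cmod z - m * cmod x)\<^sup>2 / m" using m by simp
  moreover have sq: "(a * b - m * c)\<^sup>2 / m = b\<^sup>2 * (a\<^sup>2 / m) - 2 * (a * (b * c)) + m * c\<^sup>2"
    for a b c :: real using m by (simp add: field_simps power2_eq_square)
  ultimately show ?thesis unfolding sq power2_abs by linarith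
qed (use assms in simp)

lemma gform_le_resolvent_form:
  assumes d: "spectral_decomp A d" and e: "spectral_decomp B e"
    and "positive A" "positive B" "t > 0"
  shows "gform t A B X \<le> resolvent_form t d e"
proof -
  obtain r u s w where de: "d = (r, u)" "e = (s, w)" by force
  note d' = d[unfolded de] and e' = e[unfolded de]
  have r: "0 \<le> r i" and s: "0 \<le> s j" for i j
    using positive_eigenvalue_nonneg assms d' e' by blast+
  \<comment> \<open>Here \<open>m = s j + t * r i\<close>; as \<open>t > 0\<close>, it vanishes only
    when \<open>r i\<close> does.\<close>
  have "2 * r i * Re (cinner (u i) (w j) * cinner (w j) (mv X (u i)))
     - (s j + t * r i) * (cmod (cinner (w j) (mv X (u i))))\<^sup>2
     \<le> overlap d e (i, j) * ((r i)\<^sup>2 / (s j + t * r i))" for i j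
    unfolding overlap_def de fst_conv snd_conv
    using r[of i] s[of j] assms(5) by (intro quadratic_max) (auto simp: add_nonneg_eq_0_iff)
  then show ?thesis
    unfolding gform_spectral[OF d' e'] resolvent_form_def
    using sum_UNIV_prod[of "\<lambda>i j. overlap d e (i, j) * ((r i)\<^sup>2 / (s j + t * r i))"]
    by (simp add: de sum_mono)
qed

lemma gform_attains_resolvent_form:
  assumes d: "spectral_decomp A d" and e: "spectral_decomp B e"
  shows "\<exists>X. gform t A B X = resolvent_form t d e"
proof -
  obtain r u s w where de: "d = (r, u)" "e = (s, w)" by force
  note d' = d[unfolded de] and e' = e[unfolded de]
  have ou: "onb u" and ow: "onb w" using spectral_decomp_onb d' e' by blast+
  \<comment> \<open>\<open>y j i\<close> is the maximiser of the scalar quadratic for the pair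
    \<open>(i, j)\<close>, and \<open>X\<close> is the matrix with these elements.\<close>
  define y where "y j i = of_real (r i / (s j + t * r i)) * cnj (cinner (u i) (w j))" for i j
  define X where "X = (\<lambda>a b. \<Sum>i\<in>UNIV. (\<Sum>j\<in>UNIV. y j i * w j a) * cnj (u i b))"
  have "mv X (u i) = (\<lambda>a. \<Sum>j\<in>UNIV. y j i * w j a)" for i
  proof
    fix a
    have "mv X (u i) a = (\<Sum>k\<in>UNIV. (\<Sum>j\<in>UNIV. y j k * w j a) * cinner (u k) (u i))"
      unfolding mv_def X_def sum_distrib_right[of _ UNIV "u i _"] cinner_def sum_distrib_left
      by (subst sum.swap) (simp add: mult_ac)
    then show "mv X (u i) a = (\<Sum>j\<in>UNIV. y j i * w j a)"
      by (simp add: onb_cinner[OF ou] if_distrib cong: if_cong)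
  qed
  then have y: "cinner (w j) (mv X (u i)) = y j i" for i j
    by (simp add: cinner_sum_right cinner_scale_right onb_cinner[OF ow] if_distrib cong: if_cong)
  have "2 * r i * Re (cinner (u i) (w j) * y j i) - (s j + t * r i) * (cmod (y j i))\<^sup>2
      = overlap d e (i, j) * ((r i)\<^sup>2 / (s j + t * r i))" for i j
  proof -
    have "cinner (u i) (w j) * y j i = of_real (r i / (s j + t * r i) * overlap d e (i, j))"
      unfolding y_def overlap_def de fst_conv snd_conv of_real_mult complex_norm_square
      by (simp only: mult_ac)
    then have "Re (cinner (u i) (w j) * y j i) = r i / (s j + t * r i) * overlap d e (i, j)"
      by (simp only: Re_complex_of_real)
    moreover have "(cmod (y j i))\<^sup>2 = (r i / (s j + t * r i))\<^sup>2 * overlap d e (i, j)"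
      by (simp add: y_def overlap_def de norm_mult norm_divide power_mult_distrib power_divide
          del: of_real_divide of_real_add of_real_mult)
    \<comment> \<open>For \<open>m = 0\<close> both sides are 0 by the convention for
      division.\<close>
    moreover have "2 * a * (a / m * b) - m * ((a / m)\<^sup>2 * b) = b * (a\<^sup>2 / m)" for a b m :: real
      by (cases "m = 0") (simp_all add: field_simps power2_eq_square)
    ultimately show ?thesis by simp
  qed
  then have "gform t A B X = resolvent_form t d e"
    unfolding gform_spectral[OF d' e'] y resolvent_form_def
    using sum_UNIV_prod[of "\<lambda>i j. overlap d e (i, j) * ((r i)\<^sup>2 / (s j + t * r i))"]
    by (simp add: de)
  then show ?thesis by blast
qed

section \<open>Conditional states of a measurement\<close>

lemma mmult_diff_right: "mmult A (\<lambda>i j. B i j - C i j) = (\<lambda>i j. mmult A B i j - mmult A C i j)"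
  by (simp add: mmult_def right_diff_distrib sum_subtractf)

lemma mmult_diff_left: "mmult (\<lambda>i j. B i j - C i j) A = (\<lambda>i j. mmult B A i j - mmult C A i j)"
  by (simp add: mmult_def left_diff_distrib sum_subtractf)

lemma mmult_sum_right: "mmult A (\<lambda>i j. \<Sum>k\<in>K. B k i j) = (\<lambda>i j. \<Sum>k\<in>K. mmult A (B k) i j)"
  unfolding mmult_def sum_distrib_left by (intro ext) (rule sum.swap)

lemma mmult_sum_left: "mmult (\<lambda>i j. \<Sum>k\<in>K. B k i j) A = (\<lambda>i j. \<Sum>k\<in>K. mmult (B k) A i j)"
  unfolding mmult_def sum_distrib_right by (intro ext) (rule sum.swap)

lemma trace_diff: "trace (\<lambda>i j. A i j - B i j) = trace A - trace B"
  by (simp add: trace_def sum_subtractf)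

lemma trace_sum: "trace (\<lambda>i j. \<Sum>k\<in>K. A k i j) = (\<Sum>k\<in>K. trace (A k))"
  unfolding trace_def by (rule sum.swap)

lemma adj_diff: "adj (\<lambda>i j. A i j - B i j) = (\<lambda>i j. adj A i j - adj B i j)"
  by (simp add: adj_def)

lemma adj_sum: "adj (\<lambda>i j. \<Sum>k\<in>K. A k i j) = (\<lambda>i j. \<Sum>k\<in>K. adj (A k) i j)"
  by (simp add: adj_def)

lemma adj_tensor: "adj (tensor A B) = tensor (adj A) (adj B)"
  by (auto simp: adj_def tensor_def fun_eq_iff)

lemma adj_idm [simp]: "adj idm = idm"
  by (auto simp: adj_def idm_def fun_eq_iff)

lemma sum_UNIV_pair:
  fixes f :: "('a::finite) \<times> ('b::finite) \<Rightarrow> 'c::comm_monoid_add"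
  shows "(\<Sum>x\<in>UNIV. f x) = (\<Sum>i\<in>UNIV. \<Sum>j\<in>UNIV. f (i, j))"
  using sum_UNIV_prod[of "\<lambda>i j. f (i, j)"] by simp

lemma tensor_mmult:
  fixes A C :: "('a::finite) cmat" and B D :: "('b::finite) cmat"
  shows "mmult (tensor A B) (tensor C D) = tensor (mmult A C) (mmult B D)"
proof (intro ext)
  fix x y :: "'a \<times> 'b"
  obtain a b c d where xy: "x = (a, b)" "y = (c, d)" by force
  show "mmult (tensor A B) (tensor C D) x y = tensor (mmult A C) (mmult B D) x y"
    by (simp add: xy mmult_def tensor_def sum_UNIV_pair sum_product mult_ac)
qed

lemma positive_idm: "positive idm"
  by (simp add: positive_iff Re_cinner_self_nonneg)

lemma positive_congruence:
  assumes "positive N" shows "positive (mmult K (mmult N (adj K)))"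
proof -
  have "cinner v (mv (mmult K (mmult N (adj K))) v) = cinner (mv (adj K) v) (mv N (mv (adj K) v))" for v
    by (simp add: mv_mmult cinner_mv[of _ K])
  then show ?thesis using assms by (simp add: positive_iff adj_mmult mmult_assoc)
qed

lemma positive_rank_one: "positive (\<lambda>i j. v i * cnj (v j))"
proof -
  have "cinner w (mv (\<lambda>i j. v i * cnj (v j)) w) = cnj (cinner v w) * cinner v w" for w
    unfolding cinner_commute[of v w, symmetric] cinner_commute[of w v, symmetric]
    unfolding cinner_def mv_def sum_product by (simp add: sum_distrib_left mult_ac)
  then show ?thesis by (auto simp: positive_iff adj_def fun_eq_iff mult.commute)
qed

lemma trace_mmult_rank_one: "trace (mmult A (\<lambda>i j. v i * cnj (v j))) = cinner v (mv A v)"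
  unfolding trace_def mmult_def cinner_def mv_def sum_distrib_left by (simp add: mult_ac)

text \<open>With \<open>B\<close> diagonalised, the form at \<open>z\<close> is a nonnegative
  combination of forms of \<open>A\<close> at the vectors \<open>y l\<close>, the contractions of
  \<open>z\<close> with the eigenvectors of \<open>B\<close>.\<close>

lemma positive_tensor:
  assumes "positive A" "positive B" shows "positive (tensor A B)"
proof -
  obtain b v where d: "spectral_decomp B (b, v)" using positive_spectral_decomp[OF assms(2)] by auto
  have b: "0 \<le> b l" for l by (rule positive_eigenvalue_nonneg[OF assms(2) d])
  have "0 \<le> Re (cinner z (mv (tensor A B) z))" for z
  proof -
    define y where "y l x = (\<Sum>j\<in>UNIV. cnj (v l j) * z (x, j))" for l x
    \<comment> \<open>The following interchanges move the sum over the eigenvectors \<open>l\<close>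
      outermost.\<close>
    have "cinner z (mv (tensor A B) z) = (\<Sum>x\<in>UNIV. \<Sum>i\<in>UNIV. \<Sum>x'\<in>UNIV. \<Sum>j\<in>UNIV. \<Sum>l\<in>UNIV.
        of_real (b l) * ((cnj (z (x, i)) * v l i) * (A x x' * (cnj (v l j) * z (x', j)))))"
      unfolding cinner_def mv_def sum_UNIV_pair tensor_def split_conv spectral_decomp_entry[OF d]
        sum_distrib_left sum_distrib_right
      by (simp add: mult_ac)
    also have "\<dots> = (\<Sum>x\<in>UNIV. \<Sum>i\<in>UNIV. \<Sum>x'\<in>UNIV. \<Sum>l\<in>UNIV. \<Sum>j\<in>UNIV.
        of_real (b l) * ((cnj (z (x, i)) * v l i) * (A x x' * (cnj (v l j) * z (x', j)))))"
      by (intro sum.cong refl sum.swap)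
    also have "\<dots> = (\<Sum>x\<in>UNIV. \<Sum>i\<in>UNIV. \<Sum>l\<in>UNIV. \<Sum>x'\<in>UNIV. \<Sum>j\<in>UNIV.
        of_real (b l) * ((cnj (z (x, i)) * v l i) * (A x x' * (cnj (v l j) * z (x', j)))))"
      by (intro sum.cong refl sum.swap)
    also have "\<dots> = (\<Sum>x\<in>UNIV. \<Sum>l\<in>UNIV. \<Sum>i\<in>UNIV. \<Sum>x'\<in>UNIV. \<Sum>j\<in>UNIV.
        of_real (b l) * ((cnj (z (x, i)) * v l i) * (A x x' * (cnj (v l j) * z (x', j)))))"
      by (intro sum.cong refl sum.swap)
    also have "\<dots> = (\<Sum>l\<in>UNIV. \<Sum>x\<in>UNIV. \<Sum>i\<in>UNIV. \<Sum>x'\<in>UNIV. \<Sum>j\<in>UNIV.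
        of_real (b l) * ((cnj (z (x, i)) * v l i) * (A x x' * (cnj (v l j) * z (x', j)))))"
      by (rule sum.swap)
    also have "\<dots> = (\<Sum>l\<in>UNIV. of_real (b l) * cinner (y l) (mv A (y l)))"
      unfolding cinner_def mv_def y_def cnj_sum sum_distrib_right
      unfolding sum_distrib_left by (simp add: mult_ac)
    finally have "Re (cinner z (mv (tensor A B) z)) = (\<Sum>l\<in>UNIV. b l * Re (cinner (y l) (mv A (y l))))"
      by simp
    then show ?thesis using b assms(1) by (simp add: positive_iff sum_nonneg)
  qed
  then show ?thesis using assms by (simp add: positive_iff adj_tensor)
qed

text \<open>The unnormalised conditional state on \<open>Y\<close> after outcome \<open>M\<close> on
  \<open>X\<close>; its trace is the outcome probability when \<open>C\<close> is a state.\<close>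

definition cond_op :: "('x::finite) cmat \<Rightarrow> ('x \<times> ('y::finite)) cmat \<Rightarrow> 'y cmat" where
  "cond_op M C = ptrace_X (mmult (tensor M idm) C)"

lemma cond_op_entry: "cond_op M C i j = (\<Sum>x\<in>UNIV. \<Sum>x'\<in>UNIV. M x x' * C (x', i) (x, j))"
proof -
  have "(\<Sum>y\<in>UNIV. M x x' * idm i y * C (x', y) (x, j)) = M x x' * C (x', i) (x, j)" for x x'
  proof -
    have "(\<Sum>y\<in>UNIV. M x x' * idm i y * C (x', y) (x, j))
        = (\<Sum>y\<in>UNIV. if i = y then M x x' * C (x', y) (x, j) else 0)"
      by (rule sum.cong) (auto simp: idm_def)
    then show ?thesis by simp
  qed
  then show ?thesis
    by (simp add: cond_op_def ptrace_X_def mmult_def tensor_def sum_UNIV_pair)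
qed

text \<open>Duality: \<open>cond_op M\<close> is the trace adjoint of tensoring with
  \<open>M\<close>. Positivity, supports and the variational bound are all transferred through
  it.\<close>

lemma trace_cond_op: "trace (mmult (cond_op M C) Y) = trace (mmult C (tensor M Y))"
proof -
  have "trace (mmult C (tensor M Y))
      = (\<Sum>x'\<in>UNIV. \<Sum>i\<in>UNIV. \<Sum>x\<in>UNIV. \<Sum>j\<in>UNIV. M x x' * C (x', i) (x, j) * Y j i)"
    by (simp add: trace_def mmult_def tensor_def sum_UNIV_pair mult_ac)
  also have "\<dots> = (\<Sum>i\<in>UNIV. \<Sum>x'\<in>UNIV. \<Sum>x\<in>UNIV. \<Sum>j\<in>UNIV. M x x' * C (x', i) (x, j) * Y j i)"
    by (rule sum.swap)
  also have "\<dots> = (\<Sum>i\<in>UNIV. \<Sum>x'\<in>UNIV. \<Sum>j\<in>UNIV. \<Sum>x\<in>UNIV. M x x' * C (x', i) (x, j) * Y j i)"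
    by (intro sum.cong refl sum.swap)
  also have "\<dots> = (\<Sum>i\<in>UNIV. \<Sum>j\<in>UNIV. \<Sum>x'\<in>UNIV. \<Sum>x\<in>UNIV. M x x' * C (x', i) (x, j) * Y j i)"
    by (intro sum.cong refl sum.swap)
  also have "\<dots> = (\<Sum>i\<in>UNIV. \<Sum>j\<in>UNIV. \<Sum>x\<in>UNIV. \<Sum>x'\<in>UNIV. M x x' * C (x', i) (x, j) * Y j i)"
    by (intro sum.cong refl sum.swap)
  finally show ?thesis
    by (simp add: trace_def mmult_def cond_op_entry sum_distrib_right)
qed

lemma trace_cond_op': "trace (cond_op M C) = trace (mmult C (tensor M idm))"
  using trace_cond_op[of M C idm] by simp

lemma trace_cond_op_ptrace_Y: "trace (cond_op M C) = trace (mmult M (ptrace_Y C))"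
proof -
  have "trace (cond_op M C) = (\<Sum>x\<in>UNIV. \<Sum>i\<in>UNIV. \<Sum>x'\<in>UNIV. M x x' * C (x', i) (x, i))"
    unfolding trace_def cond_op_entry by (rule sum.swap)
  also have "\<dots> = (\<Sum>x\<in>UNIV. \<Sum>x'\<in>UNIV. \<Sum>i\<in>UNIV. M x x' * C (x', i) (x, i))"
    by (intro sum.cong refl sum.swap)
  finally show ?thesis by (simp add: trace_def mmult_def ptrace_Y_def sum_distrib_left)
qed

lemma cond_op_quadratic:
  "cinner v (mv (cond_op M C) v) = trace (mmult C (tensor M (\<lambda>i j. v i * cnj (v j))))"
  by (simp add: trace_mmult_rank_one[symmetric] trace_cond_op)

lemma positive_cond_op:
  assumes "positive M" "positive C" shows "positive (cond_op M C)"
proof -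
  have M: "cnj (M x x') = M x' x" for x x'
    using assms(1) by (metis adj_def positive_iff)
  have C: "cnj (C x x') = C x' x" for x x'
    using assms(2) by (metis adj_def positive_iff)
  have "adj (cond_op M C) = cond_op M C"
    unfolding adj_def cond_op_entry cnj_sum complex_cnj_mult M C by (intro ext) (rule sum.swap)
  moreover have "0 \<le> Re (cinner v (mv (cond_op M C) v))" for v
    unfolding cond_op_quadratic
    by (intro positive_trace_mmult_nonneg positive_tensor positive_rank_one assms)
  ultimately show ?thesis by (simp add: positive_iff)
qed

text \<open>By duality a kernel vector \<open>v\<close> makes the trace of \<open>B\<close> against
  the positive operator \<open>tensor M (\<lambda>i j. v i * cnj (v j))\<close> vanish. The support
  inclusion carries this over to \<open>A\<close>.\<close>

lemma supp_le_cond_op: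
  assumes "supp_le A B" "positive A" "positive B" "positive M"
  shows "supp_le (cond_op M A) (cond_op M B)"
  unfolding supp_le_iff
proof (intro allI impI)
  fix v assume "mv (cond_op M B) v = (\<lambda>_. 0)"
  then have "cinner v (mv (cond_op M B) v) = 0" by (simp add: cinner_def)
  then have "Re (trace (mmult B (tensor M (\<lambda>i j. v i * cnj (v j))))) = 0"
    by (simp add: cond_op_quadratic)
  then have "cinner v (mv (cond_op M A) v) = 0" unfolding cond_op_quadratic
    by (intro supp_le_trace_eq_0[OF assms(1,3)] positive_tensor positive_rank_one assms(4))
  then show "mv (cond_op M A) v = (\<lambda>_. 0)"
    by (intro positive_null_vector positive_cond_op assms) simp
qed

text \<open>Kadison--Schwarz for the unital map \<open>(Y\<^sub>k) \<mapsto> \<Sum>k. N\<^sub>k Y\<^sub>k\<close>: the defect is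
  \<open>\<Sum>k. (Y\<^sub>k - X) N\<^sub>k (Y\<^sub>k - X)\<^sup>*\<close>.\<close>

lemma povm_schwarz:
  fixes N Y :: "'k \<Rightarrow> ('a::finite) cmat"
  assumes C: "positive C" and N: "\<And>k. k \<in> K \<Longrightarrow> positive (N k)"
    and N1: "(\<lambda>i j. \<Sum>k\<in>K. N k i j) = idm"
    and comm: "\<And>k. k \<in> K \<Longrightarrow> mmult (N k) (Y k) = mmult (Y k) (N k)"
  defines "X \<equiv> \<lambda>i j. \<Sum>k\<in>K. mmult (N k) (Y k) i j"
  shows "Re (trace (mmult C (mmult X (adj X))))
       \<le> (\<Sum>k\<in>K. Re (trace (mmult C (mmult (Y k) (mmult (N k) (adj (Y k)))))))"
proof -
  \<comment> \<open>Commutation lets \<open>X\<close> be read with its factors in either order, as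
    the two cross terms of the defect require.\<close>
  have X2: "(\<lambda>i j. \<Sum>k\<in>K. mmult (Y k) (N k) i j) = X"
    unfolding X_def using comm by (intro ext sum.cong) auto
  have Xa: "(\<lambda>i j. \<Sum>k\<in>K. mmult (N k) (adj (Y k)) i j) = adj X"
  proof -
    have "adj X = (\<lambda>i j. \<Sum>k\<in>K. adj (mmult (Y k) (N k)) i j)"
      unfolding X2[symmetric] by (rule adj_sum)
    also have "\<dots> = (\<lambda>i j. \<Sum>k\<in>K. mmult (N k) (adj (Y k)) i j)"
      using N by (intro ext sum.cong) (auto simp: adj_mmult positive_iff)
    finally show ?thesis by simp
  qed
  let ?D = "\<lambda>k. (\<lambda>i j. Y k i j - X i j)"
  let ?T = "trace (mmult C (mmult X (adj X)))"
  \<comment> \<open>After summation each of the last three terms becomes \<open>?T\<close>, through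
    \<open>X2\<close>, \<open>Xa\<close> and \<open>N1\<close> in turn, so the defect is the first
    sum minus \<open>?T\<close>.\<close>
  have "trace (mmult C (mmult (?D k) (mmult (N k) (adj (?D k)))))
     = trace (mmult C (mmult (Y k) (mmult (N k) (adj (Y k)))))
     - trace (mmult C (mmult (mmult (Y k) (N k)) (adj X)))
     - (trace (mmult C (mmult X (mmult (N k) (adj (Y k)))))
     - trace (mmult C (mmult X (mmult (N k) (adj X)))))" for k
    unfolding adj_diff mmult_diff_left mmult_diff_right trace_diff mmult_assoc by simp
  then have "(\<Sum>k\<in>K. trace (mmult C (mmult (?D k) (mmult (N k) (adj (?D k))))))
     = (\<Sum>k\<in>K. trace (mmult C (mmult (Y k) (mmult (N k) (adj (Y k))))))
     - (\<Sum>k\<in>K. trace (mmult C (mmult (mmult (Y k) (N k)) (adj X))))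
     - ((\<Sum>k\<in>K. trace (mmult C (mmult X (mmult (N k) (adj (Y k))))))
     - (\<Sum>k\<in>K. trace (mmult C (mmult X (mmult (N k) (adj X))))))"
    by (simp only: sum_subtractf)
  also have "(\<Sum>k\<in>K. trace (mmult C (mmult (mmult (Y k) (N k)) (adj X)))) = ?T"
    by (simp only: trace_sum[symmetric] mmult_sum_right[symmetric] mmult_sum_left[symmetric] X2)
  also have "(\<Sum>k\<in>K. trace (mmult C (mmult X (mmult (N k) (adj (Y k)))))) = ?T"
    by (simp only: trace_sum[symmetric] mmult_sum_right[symmetric] Xa)
  also have "(\<Sum>k\<in>K. trace (mmult C (mmult X (mmult (N k) (adj X))))) = ?T"
    by (simp only: trace_sum[symmetric] mmult_sum_right[symmetric] mmult_sum_left[symmetric] N1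
        mmult_idm_left)
  finally have eq: "(\<Sum>k\<in>K. trace (mmult C (mmult (?D k) (mmult (N k) (adj (?D k))))))
     = (\<Sum>k\<in>K. trace (mmult C (mmult (Y k) (mmult (N k) (adj (Y k)))))) - ?T" by simp
  have "0 \<le> (\<Sum>k\<in>K. Re (trace (mmult C (mmult (?D k) (mmult (N k) (adj (?D k)))))))"
    using C N by (intro sum_nonneg positive_trace_mmult_nonneg positive_congruence)
  also have "\<dots> = Re ((\<Sum>k\<in>K. trace (mmult C (mmult (Y k) (mmult (N k) (adj (Y k)))))) - ?T)"
    by (simp only: Re_sum[symmetric] eq)
  finally show ?thesis by simp
qed

text \<open>The Schwarz inequality for \<open>tensor (M k) idm\<close> and
  \<open>tensor idm (Y k)\<close>, which commute; duality then moves the right-hand side to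
  \<open>Y\<close>.\<close>

lemma povm_tensor_schwarz:
  fixes C :: "(('x::finite) \<times> ('y::finite)) cmat" and Y :: "'k \<Rightarrow> 'y cmat"
  assumes C: "positive C" and M: "\<And>k. k \<in> K \<Longrightarrow> positive (M k)"
    and M1: "(\<lambda>i j. \<Sum>k\<in>K. M k i j) = idm"
  defines "X \<equiv> \<lambda>i j. \<Sum>k\<in>K. tensor (M k) (Y k) i j"
  shows "Re (trace (mmult C (mmult X (adj X))))
       \<le> (\<Sum>k\<in>K. Re (trace (mmult (cond_op (M k) C) (mmult (Y k) (adj (Y k))))))"
proof -
  have "(\<lambda>i j. \<Sum>k\<in>K. tensor (M k) idm i j) = (idm :: ('x \<times> 'y) cmat)"
  proof (intro ext)
    fix x y :: "'x \<times> 'y"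
    obtain a b c d where xy: "x = (a, b)" "y = (c, d)" by force
    have "(\<Sum>k\<in>K. M k a c) = idm a c" using M1 by metis
    then show "(\<Sum>k\<in>K. tensor (M k) idm x y) = idm x y"
      by (simp add: xy tensor_def sum_distrib_right[symmetric]) (simp add: idm_def)
  qed
  moreover have "mmult (tensor (M k) idm) (tensor idm (Y k)) = tensor (M k) (Y k)" for k
    by (simp add: tensor_mmult)
  moreover have "mmult (tensor idm (Y k)) (tensor (M k) idm) = tensor (M k) (Y k)" for k
    by (simp add: tensor_mmult)
  moreover have "mmult (tensor idm (Y k)) (mmult (tensor (M k) idm) (adj (tensor idm (Y k))))
      = tensor (M k) (mmult (Y k) (adj (Y k)))" for k
    by (simp add: tensor_mmult adj_tensor)
  ultimately show ?thesis
    using povm_schwarz[of C K "\<lambda>k. tensor (M k) idm" "\<lambda>k. tensor idm (Y k)"] C M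
    unfolding X_def trace_cond_op by (simp add: positive_tensor positive_idm)
qed

text \<open>The linear terms agree by duality. The two quadratic terms enter with a minus sign and
  are controlled by the Schwarz inequality, for \<open>B\<close> with \<open>Y k\<close> and for
  \<open>A\<close> with \<open>adj (Y k)\<close>.\<close>

lemma gform_povm:
  fixes A B :: "(('x::finite) \<times> ('y::finite)) cmat"
  assumes A: "positive A" and B: "positive B" and M: "\<And>k. k \<in> K \<Longrightarrow> positive (M k)"
    and M1: "(\<lambda>i j. \<Sum>k\<in>K. M k i j) = idm" and t: "t \<ge> 0"
  shows "(\<Sum>k\<in>K. gform t (cond_op (M k) A) (cond_op (M k) B) (Y k))
      \<le> gform t A B (\<lambda>i j. \<Sum>k\<in>K. tensor (M k) (Y k) i j)"
proof -
  let ?X = "\<lambda>i j. \<Sum>k\<in>K. tensor (M k) (Y k) i j"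
  have t1: "trace (mmult A ?X) = (\<Sum>k\<in>K. trace (mmult (cond_op (M k) A) (Y k)))"
    by (simp add: mmult_sum_right trace_sum trace_cond_op)
  have t2: "Re (trace (mmult B (mmult ?X (adj ?X))))
       \<le> (\<Sum>k\<in>K. Re (trace (mmult (cond_op (M k) B) (mmult (Y k) (adj (Y k))))))"
    by (rule povm_tensor_schwarz[OF B M M1])
  have Xa: "adj ?X = (\<lambda>i j. \<Sum>k\<in>K. tensor (M k) (adj (Y k)) i j)"
    unfolding adj_sum adj_tensor using M by (intro ext sum.cong) (auto simp: positive_iff)
  have t3: "Re (trace (mmult A (mmult (adj ?X) ?X)))
       \<le> (\<Sum>k\<in>K. Re (trace (mmult (cond_op (M k) A) (mmult (adj (Y k)) (Y k)))))"
    using povm_tensor_schwarz[OF A M M1, of "\<lambda>k. adj (Y k)"] unfolding Xa[symmetric] by simp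
  from mult_left_mono[OF t3 t] t2 show ?thesis
    unfolding gform_def t1 by (simp add: sum_subtractf sum_distrib_left[symmetric])
qed

lemma gform_sum:
  "gform t (\<lambda>i j. \<Sum>k\<in>K. A k i j) (\<lambda>i j. \<Sum>k\<in>K. B k i j) X = (\<Sum>k\<in>K. gform t (A k) (B k) X)"
  unfolding gform_def mmult_sum_left trace_sum Re_sum sum_distrib_left sum_subtractf ..

lemma cond_op_sum:
  assumes "(\<lambda>i j. \<Sum>k\<in>K. M k i j) = idm"
  shows "(\<lambda>i j. \<Sum>k\<in>K. cond_op (M k) C i j) = ptrace_X C"
proof (intro ext)
  fix i j
  have "(\<Sum>k\<in>K. cond_op (M k) C i j)
      = (\<Sum>x\<in>UNIV. \<Sum>k\<in>K. \<Sum>x'\<in>UNIV. M k x x' * C (x', i) (x, j))"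
    unfolding cond_op_entry by (rule sum.swap)
  also have "\<dots> = (\<Sum>x\<in>UNIV. \<Sum>x'\<in>UNIV. \<Sum>k\<in>K. M k x x' * C (x', i) (x, j))"
    by (intro sum.cong refl sum.swap)
  also have "\<dots> = (\<Sum>x\<in>UNIV. \<Sum>x'\<in>UNIV. if x = x' then C (x', i) (x, j) else 0)"
    unfolding sum_distrib_right[symmetric] fun_cong[OF fun_cong[OF assms]]
    by (intro sum.cong refl) (simp add: idm_def)
  also have "\<dots> = ptrace_X C i j" by (simp add: ptrace_X_def)
  finally show "(\<Sum>k\<in>K. cond_op (M k) C i j) = ptrace_X C i j" .
qed

lemma trace_ptrace_X: "trace (ptrace_X C) = trace C"
  unfolding trace_def ptrace_X_def sum_UNIV_pair by (rule sum.swap)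

section \<open>Traces, sums and supports of positive operators\<close>

lemma positive_trace_real:
  assumes "positive A" shows "trace A = of_real (Re (trace A))" "0 \<le> Re (trace A)"
proof -
  obtain r u where d: "spectral_decomp A (r, u)" using positive_spectral_decomp[OF assms] by auto
  have "0 \<le> r k" for k by (rule positive_eigenvalue_nonneg[OF assms d])
  then show "trace A = of_real (Re (trace A))" "0 \<le> Re (trace A)"
    unfolding spectral_decomp_trace[OF d] by (simp_all add: sum_nonneg)
qed

lemma positive_trace_0:
  assumes "positive A" "Re (trace A) = 0" shows "A i j = 0"
proof -
  obtain r u where d: "spectral_decomp A (r, u)" using positive_spectral_decomp[OF assms(1)] by auto
  have r: "0 \<le> r k" for k by (rule positive_eigenvalue_nonneg[OF assms(1) d])
  have "(\<Sum>k\<in>UNIV. r k) = 0"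
    using assms(2) by (simp only: spectral_decomp_trace[OF d] Re_complex_of_real)
  then have "r k = 0" for k using r by (subst (asm) sum_nonneg_eq_0_iff) auto
  then show ?thesis by (simp add: spectral_decomp_entry[OF d])
qed

lemma mv_sum: "mv (\<lambda>i j. \<Sum>k\<in>K. A k i j) v = (\<lambda>i. \<Sum>k\<in>K. mv (A k) v i)"
  unfolding mv_def sum_distrib_right by (intro ext) (rule sum.swap)

lemma positive_sum:
  assumes "\<And>k. k \<in> K \<Longrightarrow> positive (A k)" shows "positive (\<lambda>i j. \<Sum>k\<in>K. A k i j)"
proof -
  have "adj (\<lambda>i j. \<Sum>k\<in>K. A k i j) = (\<lambda>i j. \<Sum>k\<in>K. A k i j)"
    unfolding adj_sum using assms by (intro ext sum.cong) (auto simp: positive_iff)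
  then show ?thesis
    using assms unfolding positive_iff mv_sum cinner_sum_right Re_sum by (auto intro: sum_nonneg)
qed

lemma positive_scale:
  assumes "positive A" "0 \<le> c" shows "positive (\<lambda>i j. of_real c * A i j)"
proof -
  have "mv (\<lambda>i j. of_real c * A i j) v = (\<lambda>i. of_real c * mv A v i)" for v
    by (simp add: mv_def sum_distrib_left mult_ac)
  moreover have "adj (\<lambda>i j. of_real c * A i j) = (\<lambda>i j. of_real c * adj A i j)"
    by (simp add: adj_def)
  ultimately show ?thesis using assms by (simp add: positive_iff cinner_scale_right)
qed

text \<open>The kernel of a sum of positive operators is the intersection of their kernels.\<close>

lemma supp_le_sum:
  assumes "finite K" "\<And>k. k \<in> K \<Longrightarrow> positive (B k)" "\<And>k. k \<in> K \<Longrightarrow> supp_le (A k) (B k)"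
  shows "supp_le (\<lambda>i j. \<Sum>k\<in>K. A k i j) (\<lambda>i j. \<Sum>k\<in>K. B k i j)"
  unfolding supp_le_iff
proof (intro allI impI)
  fix v assume "mv (\<lambda>i j. \<Sum>k\<in>K. B k i j) v = (\<lambda>_. 0)"
  then have "Re (cinner v (mv (\<lambda>i j. \<Sum>k\<in>K. B k i j) v)) = 0" by (simp add: cinner_def)
  then have "(\<Sum>k\<in>K. Re (cinner v (mv (B k) v))) = 0"
    unfolding mv_sum cinner_sum_right Re_sum .
  then have "Re (cinner v (mv (B k) v)) = 0" if "k \<in> K" for k
    using assms(1,2) that by (subst (asm) sum_nonneg_eq_0_iff) (auto simp: positive_iff)
  then have "mv (A k) v = (\<lambda>_. 0)" if "k \<in> K" for k
    using assms(2,3) that positive_null_vector unfolding supp_le_iff by blast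
  then show "mv (\<lambda>i j. \<Sum>k\<in>K. A k i j) v = (\<lambda>_. 0)" by (simp add: mv_sum)
qed

section \<open>Monotonicity under measurement and subadditivity of relative entropy\<close>

lemma spectral_decomp_fst_sum:
  assumes "spectral_decomp A d" shows "(\<Sum>k\<in>UNIV. fst d k) = Re (trace A)"
  using spectral_decomp_trace[of A "fst d" "snd d"] assms by simp

lemma spectral_decomp_snd_onb: "spectral_decomp A d \<Longrightarrow> onb (snd d)"
  using spectral_decomp_onb[of A "fst d" "snd d"] by simp

text \<open>For each \<open>t\<close>, optimal matrices \<open>Y k\<close> for the outcomes combine
  into one trial matrix for the composite system, so the maximum there is at least the sum of
  theirs.\<close>

lemma spec_entropy_povm:
  fixes A B :: "(('x::finite) \<times> ('y::finite)) cmat"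
  assumes A: "positive A" and B: "positive B" and AB: "supp_le A B"
    and M: "\<And>k. k \<in> K \<Longrightarrow> positive (M k)" and M1: "(\<lambda>i j. \<Sum>k\<in>K. M k i j) = idm"
    and d0: "spectral_decomp A d0" and e0: "spectral_decomp B e0"
    and d: "\<And>k. k \<in> K \<Longrightarrow> spectral_decomp (cond_op (M k) A) (d k)"
    and e: "\<And>k. k \<in> K \<Longrightarrow> spectral_decomp (cond_op (M k) B) (e k)"
  shows "(\<Sum>k\<in>K. spec_entropy (d k) (e k)) \<le> spec_entropy d0 e0"
proof -
  \<comment> \<open>The one-element index set presents a single entropy as a family.\<close>
  have "(\<Sum>k\<in>K. spec_entropy (d k) (e k)) \<le> (\<Sum>l\<in>{()}. spec_entropy d0 e0)"
  proof (rule spec_entropy_sum_mono)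
    show "spec_admissible (d k) (e k)" if "k \<in> K" for k
      by (rule spec_admissibleI[OF _ _ _ d[OF that] e[OF that]])
         (use that A B AB M in \<open>auto intro: positive_cond_op supp_le_cond_op\<close>)
    show "spec_admissible d0 e0" by (rule spec_admissibleI[OF A B AB d0 e0])
    show "onb (snd (d k)) \<and> onb (snd (e k))" if "k \<in> K" for k
      using d e that spectral_decomp_snd_onb by blast
    show "onb (snd d0) \<and> onb (snd e0)" using d0 e0 spectral_decomp_snd_onb by blast
    have "(\<Sum>k\<in>K. trace (cond_op (M k) A)) = trace A"
      by (simp only: trace_sum[symmetric] cond_op_sum[OF M1] trace_ptrace_X)
    then have "(\<Sum>k\<in>K. Re (trace (cond_op (M k) A))) = Re (trace A)" by (simp flip: Re_sum)
    then show "(\<Sum>k\<in>K. \<Sum>i\<in>UNIV. fst (d k) i) = (\<Sum>l\<in>{()}. \<Sum>i\<in>UNIV. fst d0 i)"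
      by (simp add: spectral_decomp_fst_sum[OF d0] spectral_decomp_fst_sum[OF d])
    fix t :: real assume t: "t > 0"
    have "\<forall>k\<in>K. \<exists>X. gform t (cond_op (M k) A) (cond_op (M k) B) X = resolvent_form t (d k) (e k)"
      using gform_attains_resolvent_form d e by blast
    then obtain Y where Y: "\<And>k. k \<in> K \<Longrightarrow>
        gform t (cond_op (M k) A) (cond_op (M k) B) (Y k) = resolvent_form t (d k) (e k)" by metis
    have "(\<Sum>k\<in>K. resolvent_form t (d k) (e k))
        = (\<Sum>k\<in>K. gform t (cond_op (M k) A) (cond_op (M k) B) (Y k))" by (simp add: Y)
    also have "\<dots> \<le> gform t A B (\<lambda>i j. \<Sum>k\<in>K. tensor (M k) (Y k) i j)"
      using t by (intro gform_povm A B M M1) auto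
    also have "\<dots> \<le> resolvent_form t d0 e0" by (rule gform_le_resolvent_form[OF d0 e0 A B t])
    finally show "(\<Sum>k\<in>K. resolvent_form t (d k) (e k)) \<le> (\<Sum>l\<in>{()}. resolvent_form t d0 e0)"
      by simp
  qed
  then show ?thesis by simp
qed

text \<open>Joint convexity in homogeneous form: the optimal \<open>X\<close> for the summed
  operators serves as a trial matrix for every \<open>k\<close>.\<close>

lemma spec_entropy_subadditive:
  assumes fin: "finite K" and A: "\<And>k. k \<in> K \<Longrightarrow> positive (A k)" and B: "\<And>k. k \<in> K \<Longrightarrow> positive (B k)"
    and AB: "\<And>k. k \<in> K \<Longrightarrow> supp_le (A k) (B k)"
    and d: "\<And>k. k \<in> K \<Longrightarrow> spectral_decomp (A k) (d k)"
    and e: "\<And>k. k \<in> K \<Longrightarrow> spectral_decomp (B k) (e k)"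
    and d0: "spectral_decomp (\<lambda>i j. \<Sum>k\<in>K. A k i j) d0"
    and e0: "spectral_decomp (\<lambda>i j. \<Sum>k\<in>K. B k i j) e0"
  shows "spec_entropy d0 e0 \<le> (\<Sum>k\<in>K. spec_entropy (d k) (e k))"
proof -
  have "(\<Sum>l\<in>{()}. spec_entropy d0 e0) \<le> (\<Sum>k\<in>K. spec_entropy (d k) (e k))"
  proof (rule spec_entropy_sum_mono)
    show "spec_admissible (d k) (e k)" if "k \<in> K" for k
      using that by (intro spec_admissibleI[OF A B AB d e])
    show "spec_admissible d0 e0"
      by (rule spec_admissibleI[OF positive_sum positive_sum supp_le_sum d0 e0])
         (use A B AB fin in auto)
    show "onb (snd (d k)) \<and> onb (snd (e k))" if "k \<in> K" for k
      using d e that spectral_decomp_snd_onb by blast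
    show "onb (snd d0) \<and> onb (snd e0)" using d0 e0 spectral_decomp_snd_onb by blast
    show "(\<Sum>l\<in>{()}. \<Sum>i\<in>UNIV. fst d0 i) = (\<Sum>k\<in>K. \<Sum>i\<in>UNIV. fst (d k) i)"
      by (simp add: spectral_decomp_fst_sum[OF d0] spectral_decomp_fst_sum[OF d] trace_sum)
    fix t :: real assume t: "t > 0"
    obtain X where "gform t (\<lambda>i j. \<Sum>k\<in>K. A k i j) (\<lambda>i j. \<Sum>k\<in>K. B k i j) X = resolvent_form t d0 e0"
      using gform_attains_resolvent_form[OF d0 e0] by blast
    then have "resolvent_form t d0 e0 = (\<Sum>k\<in>K. gform t (A k) (B k) X)" by (simp add: gform_sum)
    also have "\<dots> \<le> (\<Sum>k\<in>K. resolvent_form t (d k) (e k))"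
      using d e A B t by (intro sum_mono gform_le_resolvent_form)
    finally show "(\<Sum>l\<in>{()}. resolvent_form t d0 e0) \<le> (\<Sum>k\<in>K. resolvent_form t (d k) (e k))"
      by simp
  qed
  then show ?thesis by simp
qed

text \<open>\<open>ln (c * s) = ln c + ln s\<close> holds for \<open>s > 0\<close>; where
  \<open>s = 0\<close>, admissibility makes the weight vanish.\<close>

lemma spec_entropy_scale:
  assumes "spec_admissible d e" "onb (snd d)" "onb (snd e)" "c > 0"
  shows "spec_entropy d (\<lambda>k. c * fst e k, snd e) = spec_entropy d e - (\<Sum>i\<in>UNIV. fst d i) * ln c"
proof -
  have "overlap d e x * fst d (fst x) * (ln (fst d (fst x)) - ln (c * fst e (snd x)))
      = overlap d e x * fst d (fst x) * (ln (fst d (fst x)) - ln (fst e (snd x)))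
        - overlap d e x * fst d (fst x) * ln c" for x
  proof (cases "fst e (snd x) = 0")
    case True
    then have "overlap d e x * fst d (fst x) = 0"
      using assms(1) unfolding spec_admissible_def admissible_def by blast
    then show ?thesis by auto
  next
    case False
    then have "fst e (snd x) > 0"
      using assms(1) unfolding spec_admissible_def admissible_def by (metis UNIV_I less_eq_real_def)
    then show ?thesis using assms(4) by (simp add: ln_mult algebra_simps)
  qed
  moreover have "overlap d (\<lambda>k. c * fst e k, snd e) = overlap d e"
    by (simp add: overlap_def fun_eq_iff)
  ultimately show ?thesis
    by (simp add: spec_entropy_def sum_subtractf sum_distrib_right[symmetric]
        overlap_sum_fst[OF assms(2,3)])
qed

section \<open>Convex combinations of conditional states and the final bound\<close>

lemma convex_mset_sum:
  assumes S: "convex_mset S" and "finite K" "K \<noteq> {}"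
    and "\<And>k. k \<in> K \<Longrightarrow> A k \<in> S" "\<And>k. k \<in> K \<Longrightarrow> 0 < w k" "(\<Sum>k\<in>K. w k) = 1"
  shows "(\<lambda>i j. \<Sum>k\<in>K. of_real (w k) * A k i j) \<in> S"
  using assms(2-)
proof (induction K arbitrary: w rule: finite_ne_induct)
  case (singleton k)
  then show ?case by simp
next
  case (insert k K)
  \<comment> \<open>The first weight is split off and the others are renormalised by
    \<open>1 - t\<close>, which is positive because it is a nonempty sum of positive
    weights.\<close>
  define t where "t = w k"
  have sum: "(\<Sum>l\<in>K. w l) = 1 - t" using insert by (simp add: t_def)
  moreover have "0 < (\<Sum>l\<in>K. w l)" using insert by (intro sum_pos) auto
  ultimately have t: "t < 1" "0 < t" using insert by (auto simp: t_def)
  define w' where "w' l = w l / (1 - t)" for l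
  have "(\<lambda>i j. \<Sum>l\<in>K. of_real (w' l) * A l i j) \<in> S"
    using insert t sum by (intro insert.IH) (auto simp: w'_def sum_divide_distrib[symmetric])
  then have mem: "(\<lambda>i j. of_real t * A k i j + of_real (1 - t) * (\<Sum>l\<in>K. of_real (w' l) * A l i j)) \<in> S"
    using t insert.prems(1)[of k] by (intro S[unfolded convex_mset_def, rule_format]) auto
  have scale: "of_real (1 - t) * (of_real (w' l) * x) = of_real (w l) * x" for l and x :: complex
  proof -
    have "(1 - t) * w' l = w l" using t by (simp add: w'_def)
    then show ?thesis by (metis mult.assoc of_real_mult)
  qed
  show ?case
    using mem insert.hyps unfolding sum_distrib_left scale by (simp add: t_def)
qed

text \<open>The estimate for one \<open>\<sigma>\<close> and one measurement. The state
  \<open>\<tau>\<close> depends on the measurement; membership in \<open>PY\<close> lets it be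
  compared with the infimum over \<open>PY\<close>. The measured entropy is a real \<open>m\<close>,
  so it can be moved across inequalities.\<close>

lemma measured_chain_bound:
  fixes \<rho> \<sigma> :: "(('x::finite) \<times> ('y::finite)) cmat"
  assumes \<rho>: "density \<rho>" and \<sigma>: "density \<sigma>" and supp: "supp_le \<rho> \<sigma>" and povm: "is_povm Ms"
    and PY: "convex_mset PY"
    and cond: "\<And>k. k < length Ms \<Longrightarrow> 0 < Re (trace (cond_op (Ms ! k) \<sigma>)) \<Longrightarrow>
        (\<lambda>i j. cond_op (Ms ! k) \<sigma> i j / trace (cond_op (Ms ! k) \<sigma>)) \<in> PY"
  obtains \<tau> m where "\<tau> \<in> PY"
    "meas_rel_entropy_single Ms (ptrace_Y \<rho>) (ptrace_Y \<sigma>) = ereal m"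
    "ereal m + rel_entropy (ptrace_X \<rho>) \<tau> \<le> rel_entropy \<rho> \<sigma>"
proof -
  define M where "M k = Ms ! k" for k
  define N where "N = {..<length Ms}"
  have fin: "finite N" by (simp add: N_def)
  have M: "positive (M k)" if "k \<in> N" for k using that povm by (simp add: is_povm_def M_def N_def)
  have M1: "(\<lambda>i j. \<Sum>k\<in>N. M k i j) = idm"
    using povm by (simp add: is_povm_def M_def N_def)
  have \<rho>p: "positive \<rho>" and \<sigma>p: "positive \<sigma>" using \<rho> \<sigma> by (auto simp: density_def)
  define R where "R k = cond_op (M k) \<rho>" for k
  define S where "S k = cond_op (M k) \<sigma>" for k
  define p where "p k = Re (trace (R k))" for k
  define q where "q k = Re (trace (S k))" for k
  have Rp: "positive (R k)" and Sp: "positive (S k)" and RS: "supp_le (R k) (S k)" if "k \<in> N" for k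
    using M[OF that] \<rho>p \<sigma>p supp by (auto simp: R_def S_def intro: positive_cond_op supp_le_cond_op)
  have p0: "0 \<le> p k" and q0: "0 \<le> q k" and qS: "trace (S k) = of_real (q k)" if "k \<in> N" for k
    using positive_trace_real[OF Rp[OF that]] positive_trace_real[OF Sp[OF that]]
    by (auto simp: p_def q_def)
  \<comment> \<open>Support inclusion passes to the outcome distributions, so the measured entropy
    is finite.\<close>
  have pq: "p k = 0" if "k \<in> N" "q k = 0" for k
  proof -
    have "Re (trace (mmult \<sigma> (tensor (M k) idm))) = 0"
      using that by (simp add: q_def S_def trace_cond_op')
    then have "trace (mmult \<rho> (tensor (M k) idm)) = 0"
      using M that by (intro supp_le_trace_eq_0[OF supp \<sigma>p]) (auto intro: positive_tensor positive_idm)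
    then show ?thesis by (simp add: p_def R_def trace_cond_op')
  qed
  \<comment> \<open>Only outcomes of positive probability under \<open>\<rho>\<close> are kept; for
    these \<open>q k\<close> is positive too.\<close>
  define K where "K = {k \<in> N. 0 < p k}"
  have KN: "K \<subseteq> N" and finK: "finite K" using fin by (auto simp: K_def)
  have qK: "0 < q k" if "k \<in> K" for k
    using that pq[of k] q0[of k] by (force simp: K_def less_le)
  \<comment> \<open>Scaling by \<open>c k\<close> gives \<open>S k\<close> the trace
    \<open>p k\<close> of \<open>R k\<close>, so \<open>\<tau>\<close> is the convex combination of
    the normalised \<open>S k\<close> with weights \<open>p k\<close>.\<close>
  define c where "c k = p k / q k" for k
  have c: "0 < c k" if "k \<in> K" for k using qK[OF that] that by (simp add: c_def K_def)
  define \<tau> where "\<tau> = (\<lambda>i j. \<Sum>k\<in>K. of_real (c k) * S k i j)"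

  have sumR: "(\<lambda>i j. \<Sum>k\<in>K. R k i j) = ptrace_X \<rho>"
  proof -
    have "R k i j = 0" if "k \<in> N - K" for k i j
      using that p0[of k] Rp[of k] by (intro positive_trace_0) (auto simp: K_def p_def)
    then have "(\<Sum>k\<in>K. R k i j) = (\<Sum>k\<in>N. R k i j)" for i j
      using KN fin by (intro sum.mono_neutral_left) auto
    then show ?thesis using cond_op_sum[OF M1, of \<rho>] by (simp add: R_def)
  qed
  have "(\<Sum>k\<in>K. trace (R k)) = trace \<rho>"
    by (simp only: trace_sum[symmetric] sumR trace_ptrace_X)
  then have sump: "(\<Sum>k\<in>K. p k) = 1"
    using \<rho> by (simp add: p_def density_def flip: Re_sum)
  then have "K \<noteq> {}" by auto

  have "\<tau> \<in> PY"
  proof -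
    have "(\<lambda>i j. S k i j / of_real (q k)) \<in> PY" if "k \<in> K" for k
      using that cond[of k] qK[OF that] KN qS[of k] by (auto simp: N_def S_def M_def q_def)
    then have "(\<lambda>i j. \<Sum>k\<in>K. of_real (p k) * (S k i j / of_real (q k))) \<in> PY"
      using sump by (intro convex_mset_sum[OF PY finK \<open>K \<noteq> {}\<close>]) (auto simp: K_def)
    then show ?thesis by (simp add: \<tau>_def c_def)
  qed

  obtain d0 e0 where d0: "spectral_decomp \<rho> d0" and e0: "spectral_decomp \<sigma> e0"
    and ent0: "rel_entropy \<rho> \<sigma> = ereal (spec_entropy d0 e0)"
    by (rule rel_entropy_eq_spec_entropy[OF \<rho>p \<sigma>p supp])
  have "\<forall>k\<in>N. \<exists>d. spectral_decomp (R k) d" "\<forall>k\<in>N. \<exists>e. spectral_decomp (S k) e"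
    using Rp Sp positive_spectral_decomp by blast+
  then obtain d e where d: "\<And>k. k \<in> N \<Longrightarrow> spectral_decomp (R k) (d k)"
    and e: "\<And>k. k \<in> N \<Longrightarrow> spectral_decomp (S k) (e k)" by metis
  define e' where "e' k = ((\<lambda>j. c k * fst (e k) j), snd (e k))" for k
  have e': "spectral_decomp (\<lambda>i j. of_real (c k) * S k i j) (e' k)" if "k \<in> N" for k
    using e[OF that] by (simp add: spectral_decomp_def e'_def sum_distrib_left mult_ac)
  have S'p: "positive (\<lambda>i j. of_real (c k) * S k i j)" if "k \<in> K" for k
    using that KN c[OF that] by (intro positive_scale Sp) auto
  have RS': "supp_le (R k) (\<lambda>i j. of_real (c k) * S k i j)" if "k \<in> K" for k
  proof -
    have "mv (\<lambda>i j. of_real (c k) * S k i j) v = (\<lambda>i. of_real (c k) * mv (S k) v i)" for v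
      by (simp add: mv_def sum_distrib_left mult_ac)
    then show ?thesis using RS[of k] that KN c[OF that] by (auto simp: supp_le_iff fun_eq_iff)
  qed
  have \<tau>p: "positive \<tau>" unfolding \<tau>_def using S'p by (rule positive_sum)
  have \<rho>Yp: "positive (ptrace_X \<rho>)" unfolding sumR[symmetric] using Rp KN by (intro positive_sum) auto
  have supp\<tau>: "supp_le (ptrace_X \<rho>) \<tau>"
    unfolding \<tau>_def sumR[symmetric] using finK S'p RS' by (intro supp_le_sum)
  obtain d1 e1 where d1: "spectral_decomp (ptrace_X \<rho>) d1" and e1: "spectral_decomp \<tau> e1"
    and ent1: "rel_entropy (ptrace_X \<rho>) \<tau> = ereal (spec_entropy d1 e1)"
    by (rule rel_entropy_eq_spec_entropy[OF \<rho>Yp \<tau>p supp\<tau>])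

  \<comment> \<open>Subadditivity comes first; undoing the scaling then produces the classical terms
    \<open>p k * ln (c k)\<close>, and monotonicity under the measurement bounds the rest.\<close>
  have "spec_entropy d1 e1 \<le> (\<Sum>k\<in>K. spec_entropy (d k) (e' k))"
    using finK Rp S'p RS' d e' KN d1 e1 unfolding \<tau>_def sumR[symmetric]
    by (intro spec_entropy_subadditive[where A = R and B = "\<lambda>k i j. of_real (c k) * S k i j"]) auto
  also have "\<dots> = (\<Sum>k\<in>K. spec_entropy (d k) (e k) - p k * ln (c k))"
  proof (rule sum.cong[OF refl])
    fix k assume k: "k \<in> K"
    then have kN: "k \<in> N" using KN by auto
    have "spec_admissible (d k) (e k)" by (rule spec_admissibleI[OF Rp Sp RS d e]) (fact kN)+
    then show "spec_entropy (d k) (e' k) = spec_entropy (d k) (e k) - p k * ln (c k)"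
      unfolding e'_def p_def spectral_decomp_fst_sum[OF d[OF kN], symmetric]
      using c[OF k] spectral_decomp_snd_onb[OF d[OF kN]] spectral_decomp_snd_onb[OF e[OF kN]]
      by (intro spec_entropy_scale)
  qed
  also have "\<dots> = (\<Sum>k\<in>K. spec_entropy (d k) (e k)) - (\<Sum>k\<in>K. p k * ln (c k))"
    by (rule sum_subtractf)
  \<comment> \<open>Outside \<open>K\<close> the operator \<open>R k\<close> has trace 0, so its
    eigenvalues and its entropy term vanish.\<close>
  also have "(\<Sum>k\<in>K. spec_entropy (d k) (e k)) = (\<Sum>k\<in>N. spec_entropy (d k) (e k))"
  proof (rule sum.mono_neutral_left[OF fin KN], rule ballI)
    fix k assume k: "k \<in> N - K"
    then have kN: "k \<in> N" by auto
    have "(\<Sum>i\<in>UNIV. fst (d k) i) = 0"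
      using k p0[of k] by (simp add: spectral_decomp_fst_sum[OF d[OF kN]] K_def p_def)
    moreover have "0 \<le> fst (d k) i" for i
      using positive_eigenvalue_nonneg[OF Rp[OF kN], of "fst (d k)" "snd (d k)"] d[OF kN] by simp
    ultimately have "fst (d k) i = 0" for i by (subst (asm) sum_nonneg_eq_0_iff) auto
    then show "spec_entropy (d k) (e k) = 0" by (simp add: spec_entropy_def)
  qed
  also have "\<dots> \<le> spec_entropy d0 e0"
    using d e unfolding R_def S_def by (intro spec_entropy_povm[OF \<rho>p \<sigma>p supp M M1 d0 e0]) auto
  also have "(\<Sum>k\<in>K. p k * ln (c k)) = (\<Sum>k<length Ms. p k * ln (p k / q k))"
    unfolding c_def N_def[symmetric]
    by (rule sum.mono_neutral_left[OF fin KN]) (use p0 in \<open>force simp: K_def\<close>)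
  finally have main: "(\<Sum>k<length Ms. p k * ln (p k / q k)) + spec_entropy d1 e1 \<le> spec_entropy d0 e0"
    by simp
  have "meas_rel_entropy_single Ms (ptrace_Y \<rho>) (ptrace_Y \<sigma>)
      = ereal (\<Sum>k<length Ms. p k * ln (p k / q k))"
    using pq by (auto simp: meas_rel_entropy_single_def cl_rel_entropy_def p_def q_def R_def S_def
        M_def N_def trace_cond_op_ptrace_Y)
  with \<open>\<tau> \<in> PY\<close> show thesis by (rule that) (use main in \<open>simp add: ent0 ent1\<close>)
qed

lemma cond_op_idm: "cond_op idm C = ptrace_X C"
  using cond_op_sum[of "\<lambda>_. idm" "{()}" C] by simp

theorem theorem1:
  fixes PXY :: "(('x::finite) \<times> ('y::finite)) cmat set"
    and PX :: "'x cmat set" and PY :: "'y cmat set"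
    and MM :: "'x cmat list set"
    and \<rho> :: "('x \<times> 'y) cmat"
  assumes PXY_states: "\<forall>\<sigma>\<in>PXY. density \<sigma>" and PXY_convex: "convex_mset PXY"
    and PX_states: "\<forall>\<sigma>\<in>PX. density \<sigma>" and PX_convex: "convex_mset PX"
    and PY_states: "\<forall>\<sigma>\<in>PY. density \<sigma>" and PY_convex: "convex_mset PY"
    and MM_povm: "\<forall>Ms\<in>MM. is_povm Ms"
    and cond1: "\<forall>Ms\<in>MM. \<forall>k<length Ms. \<forall>\<sigma>\<in>PXY.
        Re (trace (mmult (tensor (Ms ! k) idm) \<sigma>)) > 0 \<longrightarrow>
        (\<lambda>i j. ptrace_X (mmult (tensor (Ms ! k) idm) \<sigma>) i j
               / trace (mmult (tensor (Ms ! k) idm) \<sigma>)) \<in> PY"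
    and cond2: "\<forall>\<sigma>\<in>PXY. ptrace_Y \<sigma> \<in> PX \<and> ptrace_X \<sigma> \<in> PY"
    and rho: "density \<rho>"
  shows "rel_ent_ent PXY \<rho> \<ge> meas_rel_ent_ent MM PX (ptrace_Y \<rho>) + rel_ent_ent PY (ptrace_X \<rho>)"
  unfolding rel_ent_ent_def[of PXY]
proof (rule INF_greatest)
  fix \<sigma> assume \<sigma>: "\<sigma> \<in> PXY"
  show "meas_rel_ent_ent MM PX (ptrace_Y \<rho>) + rel_ent_ent PY (ptrace_X \<rho>) \<le> rel_entropy \<rho> \<sigma>"
  proof (cases "supp_le \<rho> \<sigma>")
    case False
    then show ?thesis by (simp add: rel_entropy_def)
  next
    case supp: True
    have \<sigma>d: "density \<sigma>" using PXY_states \<sigma> by blast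
    have \<rho>p: "positive \<rho>" and \<sigma>p: "positive \<sigma>" using rho \<sigma>d by (auto simp: density_def)
    have \<rho>Y: "density (ptrace_X \<rho>)"
      using positive_cond_op[OF positive_idm \<rho>p] rho
      by (simp add: density_def cond_op_idm trace_ptrace_X)
    obtain E where E: "rel_entropy \<rho> \<sigma> = ereal E" using supp by (simp add: rel_entropy_def)
    let ?e = "rel_ent_ent PY (ptrace_X \<rho>)"
    have "0 \<le> ?e"
      unfolding rel_ent_ent_def using PY_states rel_entropy_nonneg[OF \<rho>Y] by (intro INF_greatest) auto
    \<comment> \<open>The marginal of \<open>\<sigma>\<close> on \<open>Y\<close> lies in
      \<open>PY\<close> and its support contains that of the marginal of \<open>\<rho>\<close>. The
      infimum is therefore a real number \<open>f\<close>, and subtracting it is safe in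
      \<open>ereal\<close>.\<close>
    moreover have "?e < \<infinity>"
    proof -
      have "supp_le (ptrace_X \<rho>) (ptrace_X \<sigma>)"
        using supp_le_cond_op[OF supp \<rho>p \<sigma>p positive_idm] by (simp add: cond_op_idm)
      then have "rel_entropy (ptrace_X \<rho>) (ptrace_X \<sigma>) < \<infinity>" by (simp add: rel_entropy_def)
      moreover have "?e \<le> rel_entropy (ptrace_X \<rho>) (ptrace_X \<sigma>)"
        unfolding rel_ent_ent_def using cond2 \<sigma> by (intro INF_lower) auto
      ultimately show ?thesis by (rule le_less_trans[rotated])
    qed
    ultimately obtain f where f: "?e = ereal f" by (cases ?e) auto
    \<comment> \<open>Replacing the entropy at \<open>\<tau>\<close> by its lower bound
      \<open>f\<close> removes the dependence on the measurement, so the bound survives the supremum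
      over \<open>MM\<close>.\<close>
    have "meas_rel_entropy_single Ms (ptrace_Y \<rho>) (ptrace_Y \<sigma>) \<le> ereal (E - f)" if "Ms \<in> MM" for Ms
    proof -
      have tr: "trace (cond_op M \<sigma>) = trace (mmult (tensor M idm) \<sigma>)" for M
        by (simp only: trace_cond_op' trace_mmult_commute[of \<sigma>])
      have PY: "(\<lambda>i j. cond_op (Ms ! k) \<sigma> i j / trace (cond_op (Ms ! k) \<sigma>)) \<in> PY"
        if "k < length Ms" "0 < Re (trace (cond_op (Ms ! k) \<sigma>))" for k
        using cond1[rule_format, OF \<open>Ms \<in> MM\<close> that(1) \<sigma> that(2)[unfolded tr]]
        unfolding tr unfolding cond_op_def .
      obtain \<tau> m where \<tau>: "\<tau> \<in> PY"
        and m: "meas_rel_entropy_single Ms (ptrace_Y \<rho>) (ptrace_Y \<sigma>) = ereal m"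
        and le: "ereal m + rel_entropy (ptrace_X \<rho>) \<tau> \<le> rel_entropy \<rho> \<sigma>"
        by (rule measured_chain_bound[OF rho \<sigma>d supp MM_povm[rule_format, OF \<open>Ms \<in> MM\<close>] PY_convex PY])
      have "ereal f \<le> rel_entropy (ptrace_X \<rho>) \<tau>"
        unfolding f[symmetric] rel_ent_ent_def using \<tau> by (rule INF_lower)
      then have "ereal m + ereal f \<le> ereal E" using le unfolding E by (meson add_left_mono order_trans)
      then show ?thesis by (simp add: m)
    qed
    then have "meas_rel_entropy MM (ptrace_Y \<rho>) (ptrace_Y \<sigma>) \<le> ereal (E - f)"
      unfolding meas_rel_entropy_def by (rule SUP_least)
    moreover have "meas_rel_ent_ent MM PX (ptrace_Y \<rho>) \<le> meas_rel_entropy MM (ptrace_Y \<rho>) (ptrace_Y \<sigma>)"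
      unfolding meas_rel_ent_ent_def using cond2 \<sigma> by (intro INF_lower) auto
    ultimately have "meas_rel_ent_ent MM PX (ptrace_Y \<rho>) + ereal f \<le> ereal (E - f) + ereal f"
      by (intro add_right_mono) (rule order_trans)
    then show ?thesis by (simp add: E f)
  qed
qed

end
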